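(* Let $\mathcal{H}$ be a supersolvable hyperplane arrangement and let $R_0$ be a canonical region of $\mathcal{H}$ (with respect to a fixed recursive supersolvable decomposition). Then the poset of regions $L:=P(\mathcal{H},R_0)$ is a lattice, and for any lattice congruence $\equiv$ on $L$, the cover graph of the quotient lattice $L/\equiv$ has a Hamiltonian path.
   Context: A hyperplane arrangement in $\mathbb{R}^d$ is a finite set $\mathcal{H}$ of linear hyperplanes; its rank is the dimension of the span of the normal vectors. Regions are the connected components of the complement of $\bigcup\mathcal{H}$; the graph of regions $G(\mathcal{H})$ has the regions as vertices, two being adjacent iff separated by exactly one hyperplane of $\mathcal{H}$ ($G(\mathcal{H})$ is connected and bipartite). An arrangement of rank $n$ is supersolvable if $n\le 2$, or $n\ge 3$ and $\mathcal{H}=\mathcal{H}_0\sqcup\mathcal{H}_1$ with $\mathcal{H}_0,\mathcal{H}_1$ nonempty, $\mathcal{H}_0$ supersolvable of rank $n-1$, and for any distinct $H',H''\in\mathcal{H}_1$ there is $H\in\mathcal{H}_0$ with $H'\cap H''\subseteq H$. For such a decomposition, let $\rho$ map each region of $\mathcal{H}$ to the region of $\mathcal{H}_0$ containing it; for each region $R$ of $\mathcal{H}$, the set $\rho^{-1}(\rho(R))$ induces a path in $G(\mathcal{H})$. Canonical regions: if the rank is at most $2$, every region is canonical; if the rank is $\ge3$, a region $R_0$ is canonical if $\rho(R_0)$ is canonical for $\mathcal{H}_0$ (with respect to its own decomposition) and $R_0$ is the first or last vertex of the path induced by $\rho^{-1}(\rho(R_0))$ in $G(\mathcal{H})$. The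 poset of regions $P(\mathcal{H},R_0)$ has the regions as ground set, the rank of a region $R$ being its graph distance from $R_0$ in $G(\mathcal{H})$, covers being the edges of $G(\mathcal{H})$ oriented from lower to higher rank, and the order being the reflexive-transitive closure of the covers. A lattice congruence on a lattice $L$ is an equivalence relation $\equiv$ such that $x\equiv x'$ and $y\equiv y'$ imply $x\wedge y\equiv x'\wedge y'$ and $x\vee y\equiv x'\vee y'$; the quotient lattice $L/\equiv$ is the set of classes, ordered by $X\le Y$ iff there are $x\in X$, $y\in Y$ with $x\le y$. The cover graph of a poset has its elements as vertices and its cover pairs as edges. *)

theory Defs
  imports "HOL-Analysis.Analysis"
begin

definition linear_hyperplane :: "'a::euclidean_space set \<Rightarrow> bool" where
  "linear_hyperplane H \<longleftrightarrow> (\<exists>a. a \<noteq> 0 \<and> H = {x. a \<bullet> x = 0})"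

definition arrangement :: "'a::euclidean_space set set \<Rightarrow> bool" where
  "arrangement \<H> \<longleftrightarrow> finite \<H> \<and> (\<forall>H\<in>\<H>. linear_hyperplane H)"

definition normals :: "'a::euclidean_space set set \<Rightarrow> 'a set" where
  "normals \<H> = {a. a \<noteq> 0 \<and> (\<exists>H\<in>\<H>. H = {x. a \<bullet> x = 0})}"

definition arr_rank :: "'a::euclidean_space set set \<Rightarrow> nat" where
  "arr_rank \<H> = dim (span (normals \<H>))"

definition regions :: "'a::euclidean_space set set \<Rightarrow> 'a set set" where
  "regions \<H> = components (- \<Union>\<H>)"

definition sep_hyps :: "'a::euclidean_space set set \<Rightarrow> 'a set \<Rightarrow> 'a set \<Rightarrow> 'a set set" where
  "sep_hyps \<H> R R' = {H\<in>\<H>. \<exists>a. H = {x. a \<bullet> x = 0} \<and> R \<subseteq> {x. a \<bullet> x < 0} \<and> R' \<subseteq> {x. 0 < a \<bullet> x}}"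

definition reg_adj :: "'a::euclidean_space set set \<Rightarrow> 'a set \<Rightarrow> 'a set \<Rightarrow> bool" where
  "reg_adj \<H> R R' \<longleftrightarrow> R \<in> regions \<H> \<and> R' \<in> regions \<H> \<and> card (sep_hyps \<H> R R') = 1"

definition reg_walk :: "'a::euclidean_space set set \<Rightarrow> 'a set list \<Rightarrow> bool" where
  "reg_walk \<H> xs \<longleftrightarrow> xs \<noteq> [] \<and> set xs \<subseteq> regions \<H> \<and>
     (\<forall>i. Suc i < length xs \<longrightarrow> reg_adj \<H> (xs ! i) (xs ! Suc i))"

definition reg_dist :: "'a::euclidean_space set set \<Rightarrow> 'a set \<Rightarrow> 'a set \<Rightarrow> nat" where
  "reg_dist \<H> R R' = (LEAST n. \<exists>xs. reg_walk \<H> xs \<and> hd xs = R \<and> last xs = R' \<and> length xs = Suc n)"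

inductive ss_decomp :: "'a::euclidean_space set set list \<Rightarrow> bool" where
  base: "arr_rank \<H> \<le> 2 \<Longrightarrow> ss_decomp [\<H>]"
| step: "\<lbrakk> arr_rank \<H> \<ge> 3; \<H>0 \<subseteq> \<H>; \<H>0 \<noteq> {}; \<H> - \<H>0 \<noteq> {};
          arr_rank \<H>0 = arr_rank \<H> - 1; ss_decomp (\<H>0 # rest);
          \<forall>H'\<in>\<H> - \<H>0. \<forall>H''\<in>\<H> - \<H>0. H' \<noteq> H'' \<longrightarrow> (\<exists>H\<in>\<H>0. H' \<inter> H'' \<subseteq> H) \<rbrakk>
        \<Longrightarrow> ss_decomp (\<H> # \<H>0 # rest)"

definition reg_proj :: "'a::euclidean_space set set \<Rightarrow> 'a set \<Rightarrow> 'a set" where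
  "reg_proj \<H>0 R = (THE R0. R0 \<in> regions \<H>0 \<and> R \<subseteq> R0)"

text \<open>Canonical regions w.r.t. a decomposition. The fibre of the projection through R induces
  a path in G(H); R is the first or last vertex of that path iff it has at most one neighbour
  inside the fibre.\<close>
fun canonical :: "'a::euclidean_space set set list \<Rightarrow> 'a set \<Rightarrow> bool" where
  "canonical [] R = False"
| "canonical [\<H>] R = (R \<in> regions \<H>)"
| "canonical (\<H> # \<H>0 # rest) R =
     (R \<in> regions \<H> \<and> canonical (\<H>0 # rest) (reg_proj \<H>0 R) \<and>
      card {R'\<in>regions \<H>. reg_proj \<H>0 R' = reg_proj \<H>0 R \<and> reg_adj \<H> R R'} \<le> 1)"

definition pr_cover :: "'a::euclidean_space set set \<Rightarrow> 'a set \<Rightarrow> 'a set \<Rightarrow> 'a set \<Rightarrow> bool" where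
  "pr_cover \<H> B R R' \<longleftrightarrow> reg_adj \<H> R R' \<and> reg_dist \<H> B R' = Suc (reg_dist \<H> B R)"

definition pr_le :: "'a::euclidean_space set set \<Rightarrow> 'a set \<Rightarrow> 'a set \<Rightarrow> 'a set \<Rightarrow> bool" where
  "pr_le \<H> B = (pr_cover \<H> B)\<^sup>*\<^sup>*"

definition partial_order_on_rel :: "'b set \<Rightarrow> ('b \<Rightarrow> 'b \<Rightarrow> bool) \<Rightarrow> bool" where
  "partial_order_on_rel A le \<longleftrightarrow>
     (\<forall>x\<in>A. le x x) \<and>
     (\<forall>x\<in>A. \<forall>y\<in>A. le x y \<and> le y x \<longrightarrow> x = y) \<and>
     (\<forall>x\<in>A. \<forall>y\<in>A. \<forall>z\<in>A. le x y \<and> le y z \<longrightarrow> le x z)"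

definition is_lub :: "'b set \<Rightarrow> ('b \<Rightarrow> 'b \<Rightarrow> bool) \<Rightarrow> 'b \<Rightarrow> 'b \<Rightarrow> 'b \<Rightarrow> bool" where
  "is_lub A le x y z \<longleftrightarrow> z \<in> A \<and> le x z \<and> le y z \<and> (\<forall>w\<in>A. le x w \<and> le y w \<longrightarrow> le z w)"

definition is_glb :: "'b set \<Rightarrow> ('b \<Rightarrow> 'b \<Rightarrow> bool) \<Rightarrow> 'b \<Rightarrow> 'b \<Rightarrow> 'b \<Rightarrow> bool" where
  "is_glb A le x y z \<longleftrightarrow> z \<in> A \<and> le z x \<and> le z y \<and> (\<forall>w\<in>A. le w x \<and> le w y \<longrightarrow> le w z)"

definition lattice_on :: "'b set \<Rightarrow> ('b \<Rightarrow> 'b \<Rightarrow> bool) \<Rightarrow> bool" where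
  "lattice_on A le \<longleftrightarrow> partial_order_on_rel A le \<and>
     (\<forall>x\<in>A. \<forall>y\<in>A. (\<exists>z. is_lub A le x y z) \<and> (\<exists>z. is_glb A le x y z))"

definition ljoin :: "'b set \<Rightarrow> ('b \<Rightarrow> 'b \<Rightarrow> bool) \<Rightarrow> 'b \<Rightarrow> 'b \<Rightarrow> 'b" where
  "ljoin A le x y = (THE z. is_lub A le x y z)"

definition lmeet :: "'b set \<Rightarrow> ('b \<Rightarrow> 'b \<Rightarrow> bool) \<Rightarrow> 'b \<Rightarrow> 'b \<Rightarrow> 'b" where
  "lmeet A le x y = (THE z. is_glb A le x y z)"

definition lattice_congruence :: "'b set \<Rightarrow> ('b \<Rightarrow> 'b \<Rightarrow> bool) \<Rightarrow> ('b \<times> 'b) set \<Rightarrow> bool" where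
  "lattice_congruence A le E \<longleftrightarrow> equiv A E \<and>
     (\<forall>x x' y y'. (x, x') \<in> E \<longrightarrow> (y, y') \<in> E \<longrightarrow>
        (ljoin A le x y, ljoin A le x' y') \<in> E \<and> (lmeet A le x y, lmeet A le x' y') \<in> E)"

definition quot_le :: "('b \<Rightarrow> 'b \<Rightarrow> bool) \<Rightarrow> 'b set \<Rightarrow> 'b set \<Rightarrow> bool" where
  "quot_le le X Y \<longleftrightarrow> (\<exists>x\<in>X. \<exists>y\<in>Y. le x y)"

definition covers_in :: "'b set \<Rightarrow> ('b \<Rightarrow> 'b \<Rightarrow> bool) \<Rightarrow> 'b \<Rightarrow> 'b \<Rightarrow> bool" where
  "covers_in A le x y \<longleftrightarrow> x \<in> A \<and> y \<in> A \<and> le x y \<and> x \<noteq> y \<and>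
     \<not> (\<exists>z\<in>A. le x z \<and> le z y \<and> z \<noteq> x \<and> z \<noteq> y)"

definition cover_graph_ham_path :: "'b set \<Rightarrow> ('b \<Rightarrow> 'b \<Rightarrow> bool) \<Rightarrow> bool" where
  "cover_graph_ham_path A le \<longleftrightarrow> (\<exists>xs. distinct xs \<and> set xs = A \<and>
     (\<forall>i. Suc i < length xs \<longrightarrow>
        covers_in A le (xs ! i) (xs ! Suc i) \<or> covers_in A le (xs ! Suc i) (xs ! i)))"

end

theory Submission
  imports Defs
begin

text \<open>The span of the normals of \<open>\<H>0\<close> has codimension one in that of \<open>\<H>\<close>, so there is a direction
  \<open>v\<close> parallel to all hyperplanes of \<open>\<H>0\<close>; modularity forces every other hyperplane to be transverse
  to \<open>v\<close>, and fixes the order in which lines with direction \<open>v\<close> cross these over a given region of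
  \<open>\<H>0\<close>. Hence the fibres of the projection \<open>\<rho>\<close> are chains. Regions are ordered by inclusion of
  the sets of hyperplanes separating them from the base region, which is first in its fibre (up to the
  sign of \<open>v\<close>). The first and last regions of the fibres form a down-closed and an up-closed copy of
  the poset of \<open>\<H>0\<close>, which are a left and a right adjoint of \<open>\<rho>\<close>. So a congruence on the poset of
  \<open>\<H>\<close> restricts to one on that of \<open>\<H>0\<close>, both copies carry the same one, and each fibre over a class
  becomes a path in the quotient; a Hamiltonian path for \<open>\<H>0\<close> is lifted by traversing these
  paths alternately upwards and downwards. In rank two, any wall of the base region can serve as \<open>\<H>0\<close>,
  so the induction effectively starts from the empty arrangement.\<close>

section \<open>Quotients of finite lattices\<close>

text \<open>Geometry enters only through the locale \<open>chain_extension\<close>, which speaks of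
  families of sets ordered by inclusion. There \<open>insertion\<close> says that over every base
  element each member of \<open>H1\<close> is acquired alone at some moment, and \<open>flip\<close>
  encodes that H \<inter> K lies in some L of \<H>0, whose side settles which of H and K comes
  first. The lattice property cannot be assumed; it is carried along in the induction. A join lies
  over the join e of the projections, as the least fibre element containing the prescribed part of
  \<open>H1\<close>. It is below every upper bound w because the \<open>H0\<close>-part of e lies
  between those of the joined elements and that of w, so acquisition orders shared by both ends also
  hold over e. In the quotient the obstacle is that one class may meet many fibres. A class of the
  congruence \<open>E\<close> meets every fibre over exactly one class of the induced congruence
  \<open>E0\<close> and no other fibre. Hence a single fibre per class of \<open>E0\<close>, over an
  arbitrary representative, visits every class of \<open>E\<close> exactly once.\<close>

locale carrier_lattice =
  fixes A :: "'b set" and le :: "'b \<Rightarrow> 'b \<Rightarrow> bool"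
  assumes lattice: "lattice_on A le"
begin

lemma le_refl: "x \<in> A \<Longrightarrow> le x x"
  using lattice by (auto simp: lattice_on_def partial_order_on_rel_def)

lemma le_antisym: "x \<in> A \<Longrightarrow> y \<in> A \<Longrightarrow> le x y \<Longrightarrow> le y x \<Longrightarrow> x = y"
  using lattice unfolding lattice_on_def partial_order_on_rel_def by blast

lemma le_trans: "x \<in> A \<Longrightarrow> y \<in> A \<Longrightarrow> z \<in> A \<Longrightarrow> le x y \<Longrightarrow> le y z \<Longrightarrow> le x z"
  using lattice unfolding lattice_on_def partial_order_on_rel_def by blast

lemma lub_exists:
  assumes "x \<in> A" "y \<in> A"
  obtains z where "is_lub A le x y z"
  using lattice assms by (auto simp: lattice_on_def)

lemma glb_exists:
  assumes "x \<in> A" "y \<in> A"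
  obtains z where "is_glb A le x y z"
  using lattice assms by (auto simp: lattice_on_def)

lemma ljoin_eq: "is_lub A le x y z \<Longrightarrow> ljoin A le x y = z"
  unfolding ljoin_def by (rule the_equality) (auto simp: is_lub_def intro: le_antisym)

lemma lmeet_eq: "is_glb A le x y z \<Longrightarrow> lmeet A le x y = z"
  unfolding lmeet_def by (rule the_equality) (auto simp: is_glb_def intro: le_antisym)

lemma lub_of_le: "x \<in> A \<Longrightarrow> y \<in> A \<Longrightarrow> le x y \<Longrightarrow> is_lub A le x y y"
  by (auto simp: is_lub_def intro: le_refl)

lemma glb_of_le: "x \<in> A \<Longrightarrow> y \<in> A \<Longrightarrow> le x y \<Longrightarrow> is_glb A le x y x"
  by (auto simp: is_glb_def intro: le_refl)

lemma lub_commute: "is_lub A le x y z = is_lub A le y x z"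
  by (auto simp: is_lub_def)

lemma glb_commute: "is_glb A le x y z = is_glb A le y x z"
  by (auto simp: is_glb_def)

end

locale quotient_lattice = carrier_lattice A le
  for A :: "'b set" and le :: "'b \<Rightarrow> 'b \<Rightarrow> bool" +
  fixes E :: "('b \<times> 'b) set"
  assumes congruence: "lattice_congruence A le E"
begin

lemma equiv: "equiv A E"
  using congruence by (simp add: lattice_congruence_def)

lemma E_refl: "x \<in> A \<Longrightarrow> (x, x) \<in> E"
  using equiv by (auto simp: equiv_def refl_on_def)

lemma E_sym: "(x, y) \<in> E \<Longrightarrow> (y, x) \<in> E"
  using equiv by (auto simp: equiv_def sym_def)

lemma E_trans: "(x, y) \<in> E \<Longrightarrow> (y, z) \<in> E \<Longrightarrow> (x, z) \<in> E"
  using equiv unfolding equiv_def trans_def by blast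

lemma E_in: "(x, y) \<in> E \<Longrightarrow> x \<in> A \<and> y \<in> A"
  using equiv by (auto simp: equiv_def)

lemma class_eq: "x \<in> A \<Longrightarrow> y \<in> A \<Longrightarrow> E `` {x} = E `` {y} \<longleftrightarrow> (x, y) \<in> E"
  using equiv by (simp add: eq_equiv_class_iff)

text \<open>The congruence is stated for \<open>ljoin\<close> and \<open>lmeet\<close>, which are
  definite descriptions. This form and its dual allow arguments with the predicates
  \<open>is_lub\<close> and \<open>is_glb\<close> instead.\<close>

lemma E_lub:
  assumes "is_lub A le x y z" "is_lub A le x' y' z'" "(x, x') \<in> E" "(y, y') \<in> E"
  shows "(z, z') \<in> E"
  using congruence assms ljoin_eq[OF assms(1)] ljoin_eq[OF assms(2)]
  unfolding lattice_congruence_def by metis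

lemma E_glb:
  assumes "is_glb A le x y z" "is_glb A le x' y' z'" "(x, x') \<in> E" "(y, y') \<in> E"
  shows "(z, z') \<in> E"
  using congruence assms lmeet_eq[OF assms(1)] lmeet_eq[OF assms(2)]
  unfolding lattice_congruence_def by metis

text \<open>Joining both members of the pair (x, z) with y gives y and z.\<close>

lemma E_convex:
  assumes "(x, z) \<in> E" "y \<in> A" "le x y" "le y z"
  shows "(y, z) \<in> E"
proof (rule E_lub)
  show "is_lub A le x y y" "is_lub A le z y z"
    using assms E_in lub_of_le lub_commute by blast+
qed (use assms E_refl in auto)

text \<open>The witness is (x join z) meet y. Comparability of the classes of x and z makes the join
  equivalent to z, that of z and y keeps it so after the meet, and x below y keeps the result in the
  interval.\<close>

lemma quot_between:
  assumes A: "x \<in> A" "y \<in> A" "z \<in> A" and "le x y"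
    and xz: "quot_le le (E `` {x}) (E `` {z})" and zy: "quot_le le (E `` {z}) (E `` {y})"
  obtains w where "w \<in> A" "le x w" "le w y" "(w, z) \<in> E"
proof -
  obtain x' z' where 1: "(x, x') \<in> E" "(z, z') \<in> E" "le x' z'"
    using xz by (auto simp: quot_le_def)
  obtain z'' y'' where 2: "(z, z'') \<in> E" "(y, y'') \<in> E" "le z'' y''"
    using zy by (auto simp: quot_le_def)
  obtain v where v: "is_lub A le x z v" using A lub_exists by blast
  then have "v \<in> A" "le x v" by (auto simp: is_lub_def)
  have "(v, z') \<in> E"
    using E_lub[OF v lub_of_le[of x' z']] 1 E_in by blast
  obtain w where w: "is_glb A le v y w" using \<open>v \<in> A\<close> A glb_exists by blast
  have "(v, z'') \<in> E"
    using \<open>(v, z') \<in> E\<close> 1 2 E_sym E_trans by blast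
  then have "(w, z'') \<in> E"
    using E_glb[OF w glb_of_le[of z'' y'']] 2 E_in by blast
  then have "(w, z) \<in> E" using 2 E_sym E_trans by blast
  moreover have "w \<in> A" "le w y" "le x w"
    using w \<open>le x v\<close> \<open>le x y\<close> A by (auto simp: is_glb_def)
  ultimately show ?thesis using that by blast
qed

text \<open>A cover of classes can be tested in one interval of the lattice itself: by
  \<open>quot_between\<close>, any class strictly in between would have a member in that
  interval.\<close>

lemma covers_in_quotient:
  assumes A: "x \<in> A" "y \<in> A" and "le x y" "(x, y) \<notin> E"
    and between: "\<And>z. z \<in> A \<Longrightarrow> le x z \<Longrightarrow> le z y \<Longrightarrow> (z, x) \<in> E \<or> (z, y) \<in> E"
  shows "covers_in (A // E) (quot_le le) (E `` {x}) (E `` {y})"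
  unfolding covers_in_def
proof (intro conjI notI)
  show "E `` {x} \<in> A // E" "E `` {y} \<in> A // E" using A by (auto intro: quotientI)
  show "quot_le le (E `` {x}) (E `` {y})"
    using A \<open>le x y\<close> E_refl by (auto simp: quot_le_def)
  show False if "E `` {x} = E `` {y}" using that A class_eq assms(4) by blast
  assume "\<exists>Z\<in>A // E. quot_le le (E `` {x}) Z \<and> quot_le le Z (E `` {y}) \<and>
                      Z \<noteq> E `` {x} \<and> Z \<noteq> E `` {y}"
  then obtain z where z: "z \<in> A" "quot_le le (E `` {x}) (E `` {z})" "quot_le le (E `` {z}) (E `` {y})"
      "(z, x) \<notin> E" "(z, y) \<notin> E"
    using class_eq A by (auto elim!: quotientE)
  obtain w where "w \<in> A" "le x w" "le w y" "(w, z) \<in> E"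
    using quot_between[OF A z(1) \<open>le x y\<close> z(2,3)] by blast
  then show False using between z(4,5) E_sym E_trans by blast
qed

end

section \<open>Zigzagging through fibres\<close>

lemma zigzag_path:
  assumes sym: "\<And>x y. adj x y \<Longrightarrow> adj y x"
    and "distinct Xs" "Xs \<noteq> []"
    and path: "\<And>X. X \<in> set Xs \<Longrightarrow> p X \<noteq> [] \<and> distinct (p X) \<and> successively adj (p X)"
    and disj: "\<And>X Y. X \<in> set Xs \<Longrightarrow> Y \<in> set Xs \<Longrightarrow> X \<noteq> Y \<Longrightarrow> set (p X) \<inter> set (p Y) = {}"
    and rungs: "successively (\<lambda>X Y. adj (hd (p X)) (hd (p Y)) \<and> adj (last (p X)) (last (p Y))) Xs"
  shows "\<exists>q. q \<noteq> [] \<and> distinct q \<and> successively adj q \<and> set q = (\<Union>X\<in>set Xs. set (p X)) \<and>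
             hd q = (if up then hd (p (hd Xs)) else last (p (hd Xs)))"
  using assms(2-)
proof (induction Xs arbitrary: up)
  case (Cons X Xs)
  define r where "r = (if up then p X else rev (p X))"
  have pX: "p X \<noteq> []" "distinct (p X)" "successively adj (p X)" using Cons.prems(3) by auto
  have "successively adj (rev (p X))"
    using successively_mono[OF pX(3)] sym by (simp add: successively_rev)
  then have r: "r \<noteq> []" "distinct r" "successively adj r" "set r = set (p X)"
      "hd r = (if up then hd (p X) else last (p X))" "last r = (if up then last (p X) else hd (p X))"
    using pX by (auto simp: r_def hd_rev last_rev)
  show ?case
  proof (cases "Xs = []")
    case True
    then show ?thesis using r by (intro exI[of _ r]) auto
  next
    case False
    \<comment> \<open>Traversing \<open>p X\<close> in the direction \<open>up\<close> ends at its
      other extremity, so the remaining path has to start at that end: the direction alternates,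
      which is why \<open>up\<close> is generalised in the induction.\<close>
    have "\<exists>q. q \<noteq> [] \<and> distinct q \<and> successively adj q \<and> set q = (\<Union>X\<in>set Xs. set (p X)) \<and>
             hd q = (if \<not> up then hd (p (hd Xs)) else last (p (hd Xs)))"
      using Cons.prems False by (intro Cons.IH) (auto simp: successively_Cons)
    then obtain q where q: "q \<noteq> []" "distinct q" "successively adj q"
      "set q = (\<Union>X\<in>set Xs. set (p X))" "hd q = (if \<not> up then hd (p (hd Xs)) else last (p (hd Xs)))"
      by blast
    have "set (p X) \<inter> set q = {}"
    proof -
      have "set (p X) \<inter> set (p Y) = {}" if "Y \<in> set Xs" for Y
        using Cons.prems(1,4) that by (metis distinct.simps(2) list.set_intros)
      then show ?thesis using q(4) by blast
    qed
    moreover have "adj (last r) (hd q)"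
      using Cons.prems(5) False r(6) q(5) by (auto simp: successively_Cons)
    ultimately show ?thesis
      using q r by (intro exI[of _ "r @ q"]) (auto simp: successively_append_iff)
  qed
qed simp

text \<open>The left adjoint \<open>\<sigma>\<close> of \<open>\<rho>\<close> embeds \<open>A0\<close> as a down-closed subset, the right adjoint \<open>\<tau>\<close>
  embeds it as an up-closed subset, and the fibres of \<open>\<rho>\<close> are chains.\<close>

locale chain_fibration = up: carrier_lattice A le + down: carrier_lattice A0 le0
  for A :: "'b set" and le :: "'b \<Rightarrow> 'b \<Rightarrow> bool" and A0 :: "'c set" and le0 :: "'c \<Rightarrow> 'c \<Rightarrow> bool" +
  fixes \<rho> :: "'b \<Rightarrow> 'c" and \<sigma> \<tau> :: "'c \<Rightarrow> 'b"
  assumes finite: "finite A"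
    and \<rho>_in: "x \<in> A \<Longrightarrow> \<rho> x \<in> A0"
    and \<sigma>_in: "c \<in> A0 \<Longrightarrow> \<sigma> c \<in> A"
    and \<tau>_in: "c \<in> A0 \<Longrightarrow> \<tau> c \<in> A"
    and \<rho>_\<sigma>: "c \<in> A0 \<Longrightarrow> \<rho> (\<sigma> c) = c"
    and \<rho>_\<tau>: "c \<in> A0 \<Longrightarrow> \<rho> (\<tau> c) = c"
    and \<sigma>_adj: "c \<in> A0 \<Longrightarrow> x \<in> A \<Longrightarrow> le (\<sigma> c) x \<longleftrightarrow> le0 c (\<rho> x)"
    and \<tau>_adj: "c \<in> A0 \<Longrightarrow> x \<in> A \<Longrightarrow> le x (\<tau> c) \<longleftrightarrow> le0 (\<rho> x) c"
    and \<sigma>_down: "c \<in> A0 \<Longrightarrow> x \<in> A \<Longrightarrow> le x (\<sigma> c) \<Longrightarrow> \<sigma> (\<rho> x) = x"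
    and \<tau>_up: "c \<in> A0 \<Longrightarrow> x \<in> A \<Longrightarrow> le (\<tau> c) x \<Longrightarrow> \<tau> (\<rho> x) = x"
    and chain: "x \<in> A \<Longrightarrow> y \<in> A \<Longrightarrow> \<rho> x = \<rho> y \<Longrightarrow> le x y \<or> le y x"
begin

lemmas in_A = \<rho>_in \<sigma>_in \<tau>_in

text \<open>Since \<sigma> is left adjoint to \<rho>, \<open>\<sigma> (\<rho> x)\<close> lies below
  x, hence below y; the adjunction turns this back into a comparison in the base.\<close>

lemma \<rho>_mono:
  assumes "x \<in> A" "y \<in> A" "le x y"
  shows "le0 (\<rho> x) (\<rho> y)"
proof -
  have "le (\<sigma> (\<rho> x)) x" using assms \<sigma>_adj in_A down.le_refl by simp
  then have "le (\<sigma> (\<rho> x)) y" using assms up.le_trans in_A by blast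
  then show ?thesis using assms \<sigma>_adj in_A by simp
qed

lemma \<sigma>_mono: "c \<in> A0 \<Longrightarrow> d \<in> A0 \<Longrightarrow> le0 c d \<Longrightarrow> le (\<sigma> c) (\<sigma> d)"
  by (simp add: \<sigma>_adj in_A \<rho>_\<sigma>)

lemma \<tau>_mono: "c \<in> A0 \<Longrightarrow> d \<in> A0 \<Longrightarrow> le0 c d \<Longrightarrow> le (\<tau> c) (\<tau> d)"
  by (simp add: \<tau>_adj in_A \<rho>_\<tau>)

lemma \<sigma>_lub:
  assumes "is_lub A0 le0 c d e" "c \<in> A0" "d \<in> A0"
  shows "is_lub A le (\<sigma> c) (\<sigma> d) (\<sigma> e)"
  unfolding is_lub_def
proof (intro conjI ballI impI)
  fix w assume "w \<in> A" "le (\<sigma> c) w \<and> le (\<sigma> d) w"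
  then show "le (\<sigma> e) w"
    using assms \<rho>_in by (auto simp: is_lub_def \<sigma>_adj)
qed (use assms \<sigma>_mono \<sigma>_in in \<open>auto simp: is_lub_def\<close>)

text \<open>A left adjoint need not preserve meets. Here down-closedness helps: every lower bound of
  elements \<open>\<sigma> c\<close> and \<open>\<sigma> d\<close> is itself \<sigma> of its
  projection.\<close>

lemma \<sigma>_glb:
  assumes "is_glb A0 le0 c d e" "c \<in> A0" "d \<in> A0"
  shows "is_glb A le (\<sigma> c) (\<sigma> d) (\<sigma> e)"
  unfolding is_glb_def
proof (intro conjI ballI impI)
  fix w assume w: "w \<in> A" "le w (\<sigma> c) \<and> le w (\<sigma> d)"
  then have "\<sigma> (\<rho> w) = w" using assms \<sigma>_down by blast
  moreover have "le0 (\<rho> w) c" "le0 (\<rho> w) d"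
    using w \<rho>_mono[of w "\<sigma> c"] \<rho>_mono[of w "\<sigma> d"] assms by (auto simp: in_A \<rho>_\<sigma>)
  then have "le0 (\<rho> w) e" using assms w in_A by (auto simp: is_glb_def)
  ultimately show "le w (\<sigma> e)"
    using \<sigma>_mono[of "\<rho> w" e] w assms in_A by (auto simp: is_glb_def)
qed (use assms \<sigma>_mono \<sigma>_in in \<open>auto simp: is_glb_def\<close>)

text \<open>Having the right adjoint \<tau>, \<rho> preserves joins; having the left adjoint
  \<sigma>, it preserves meets in the next lemma.\<close>

lemma \<rho>_lub:
  assumes "is_lub A le x y z" "x \<in> A" "y \<in> A"
  shows "is_lub A0 le0 (\<rho> x) (\<rho> y) (\<rho> z)"
  unfolding is_lub_def
proof (intro conjI ballI impI)
  fix w assume "w \<in> A0" "le0 (\<rho> x) w \<and> le0 (\<rho> y) w"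
  then show "le0 (\<rho> z) w"
    using assms \<tau>_in by (auto simp: is_lub_def simp flip: \<tau>_adj)
qed (use assms \<rho>_mono \<rho>_in in \<open>auto simp: is_lub_def\<close>)

lemma \<rho>_glb:
  assumes "is_glb A le x y z" "x \<in> A" "y \<in> A"
  shows "is_glb A0 le0 (\<rho> x) (\<rho> y) (\<rho> z)"
  unfolding is_glb_def
proof (intro conjI ballI impI)
  fix w assume "w \<in> A0" "le0 w (\<rho> x) \<and> le0 w (\<rho> y)"
  then show "le0 w (\<rho> z)"
    using assms \<sigma>_in by (auto simp: is_glb_def simp flip: \<sigma>_adj)
qed (use assms \<rho>_mono \<rho>_in in \<open>auto simp: is_glb_def\<close>)

text \<open>Meeting with \<open>\<sigma> c\<close> for any c above \<open>\<rho> x\<close> drops x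
  to the bottom of its own fibre, because everything below \<open>\<sigma> c\<close> lies in the
  image of \<sigma>. One such meet thus moves two related elements to their bottoms simultaneously;
  \<open>lub_\<tau>\<close> does the same for tops.\<close>

lemma glb_\<sigma>:
  assumes "x \<in> A" "c \<in> A0" "le0 (\<rho> x) c"
  shows "is_glb A le x (\<sigma> c) (\<sigma> (\<rho> x))"
  unfolding is_glb_def
proof (intro conjI ballI impI)
  fix w assume w: "w \<in> A" "le w x \<and> le w (\<sigma> c)"
  then show "le w (\<sigma> (\<rho> x))"
    using \<sigma>_down[of c w] \<sigma>_mono[of "\<rho> w" "\<rho> x"] \<rho>_mono[of w x] assms in_A by metis
qed (use assms in \<open>auto simp: in_A \<sigma>_adj \<rho>_\<sigma> down.le_refl\<close>)

lemma lub_\<tau>: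
  assumes "x \<in> A" "c \<in> A0" "le0 c (\<rho> x)"
  shows "is_lub A le x (\<tau> c) (\<tau> (\<rho> x))"
  unfolding is_lub_def
proof (intro conjI ballI impI)
  fix w assume w: "w \<in> A" "le x w \<and> le (\<tau> c) w"
  then show "le (\<tau> (\<rho> x)) w"
    using \<tau>_up[of c w] \<tau>_mono[of "\<rho> x" "\<rho> w"] \<rho>_mono[of x w] assms in_A by metis
qed (use assms in \<open>auto simp: in_A \<tau>_adj \<rho>_\<tau> down.le_refl\<close>)

end

section \<open>The congruence induced on the base, and the lifted Hamiltonian path\<close>

locale quotient_fibration = chain_fibration A le A0 le0 \<rho> \<sigma> \<tau> + up: quotient_lattice A le E
  for A :: "'b set" and le :: "'b \<Rightarrow> 'b \<Rightarrow> bool" and A0 :: "'c set" and le0 :: "'c \<Rightarrow> 'c \<Rightarrow> bool"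
    and \<rho> \<sigma> \<tau> E
begin

text \<open>Read off the bottom copy, where \<sigma> preserves joins and meets. That the top copy
  carries the same relation follows from \<open>E_imp_E0\<close> and
  \<open>E0_imp_\<tau>\<close>.\<close>

definition E0 :: "('c \<times> 'c) set" where
  "E0 = {(c, d). c \<in> A0 \<and> d \<in> A0 \<and> (\<sigma> c, \<sigma> d) \<in> E}"

lemma E0_iff: "c \<in> A0 \<Longrightarrow> d \<in> A0 \<Longrightarrow> (c, d) \<in> E0 \<longleftrightarrow> (\<sigma> c, \<sigma> d) \<in> E"
  by (auto simp: E0_def)

lemma E0_congruence: "lattice_congruence A0 le0 E0"
  unfolding lattice_congruence_def
proof (intro conjI allI impI)
  show "equiv A0 E0"
  proof (rule equivI)
    show "E0 \<subseteq> A0 \<times> A0" by (auto simp: E0_def)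
    show "refl_on A0 E0" by (auto simp: refl_on_def E0_def up.E_refl in_A)
    show "sym E0" by (auto simp: sym_def E0_def up.E_sym)
    show "trans E0" by (auto simp: trans_def E0_def dest: up.E_trans)
  qed
next
  fix c c' d d' assume cd: "(c, c') \<in> E0" "(d, d') \<in> E0"
  then have A0: "c \<in> A0" "c' \<in> A0" "d \<in> A0" "d' \<in> A0"
    and E: "(\<sigma> c, \<sigma> c') \<in> E" "(\<sigma> d, \<sigma> d') \<in> E" by (auto simp: E0_def)
  obtain j j' where j: "is_lub A0 le0 c d j" "is_lub A0 le0 c' d' j'"
    using A0 down.lub_exists by metis
  then have "j \<in> A0" "j' \<in> A0" by (auto simp: is_lub_def)
  then show "(ljoin A0 le0 c d, ljoin A0 le0 c' d') \<in> E0"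
    using up.E_lub[OF \<sigma>_lub[OF j(1)] \<sigma>_lub[OF j(2)]] A0 E j by (simp add: down.ljoin_eq E0_iff)
  obtain m m' where m: "is_glb A0 le0 c d m" "is_glb A0 le0 c' d' m'"
    using A0 down.glb_exists by metis
  then have "m \<in> A0" "m' \<in> A0" by (auto simp: is_glb_def)
  then show "(lmeet A0 le0 c d, lmeet A0 le0 c' d') \<in> E0"
    using up.E_glb[OF \<sigma>_glb[OF m(1)] \<sigma>_glb[OF m(2)]] A0 E m by (simp add: down.lmeet_eq E0_iff)
qed

sublocale down: quotient_lattice A0 le0 E0
  by unfold_locales (rule E0_congruence)

text \<open>Meet both elements with \<open>\<sigma> j\<close>, where j is the join of their
  projections: by \<open>glb_\<sigma>\<close> this yields the bottoms of their fibres.\<close>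

lemma E_imp_E0:
  assumes "(x, y) \<in> E"
  shows "(\<rho> x, \<rho> y) \<in> E0"
proof -
  have A: "x \<in> A" "y \<in> A" using assms up.E_in by auto
  obtain j where j: "is_lub A0 le0 (\<rho> x) (\<rho> y) j" using A in_A down.lub_exists by metis
  then have "j \<in> A0" "le0 (\<rho> x) j" "le0 (\<rho> y) j" by (auto simp: is_lub_def)
  then have "(\<sigma> (\<rho> x), \<sigma> (\<rho> y)) \<in> E"
    using up.E_glb[OF glb_\<sigma> glb_\<sigma> assms up.E_refl] A in_A by blast
  then show ?thesis using A in_A by (simp add: E0_iff)
qed

text \<open>Join \<open>\<sigma> c\<close> and \<open>\<sigma> d\<close> with
  \<open>\<tau> m\<close>, where m is the meet of c and d: by \<open>lub_\<tau>\<close> this lifts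
  both to the tops of their fibres.\<close>

lemma E0_imp_\<tau>:
  assumes "(c, d) \<in> E0"
  shows "(\<tau> c, \<tau> d) \<in> E"
proof -
  have A: "c \<in> A0" "d \<in> A0" "(\<sigma> c, \<sigma> d) \<in> E" using assms by (auto simp: E0_def)
  obtain m where m: "is_glb A0 le0 c d m" using A down.glb_exists by metis
  then have "m \<in> A0" "le0 m c" "le0 m d" by (auto simp: is_glb_def)
  then show ?thesis
    using up.E_lub[OF lub_\<tau>[of "\<sigma> c" m] lub_\<tau>[of "\<sigma> d" m] A(3) up.E_refl] A in_A
    by (simp add: \<rho>_\<sigma>)
qed

text \<open>The class of y is followed down and then up. With d the meet of c and
  \<open>\<rho> y\<close>, the meet of y with \<open>\<tau> d\<close> stays in the class, because
  \<open>\<tau> d\<close> is equivalent to \<open>\<tau> (\<rho> y)\<close>, which is above y; it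
  lies over d. Joining with \<open>\<sigma> c\<close>, which is equivalent to
  \<open>\<sigma> d\<close>, then moves it to the fibre over c.\<close>

lemma fibre_meets_class:
  assumes "y \<in> A" "(c, \<rho> y) \<in> E0"
  obtains x where "x \<in> A" "\<rho> x = c" "(x, y) \<in> E"
proof -
  have c: "c \<in> A0" "\<rho> y \<in> A0" using assms in_A down.E_in by auto
  obtain d where d: "is_glb A0 le0 c (\<rho> y) d" using c down.glb_exists by metis
  then have "d \<in> A0" "le0 d c" "le0 d (\<rho> y)" by (auto simp: is_glb_def)
  have "is_glb A0 le0 (\<rho> y) (\<rho> y) (\<rho> y)" using c by (simp add: down.glb_of_le down.le_refl)
  then have dy: "(d, \<rho> y) \<in> E0"
    using down.E_glb[OF d _ assms(2) down.E_refl] c by blast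
  then have dc: "(d, c) \<in> E0" using assms down.E_sym down.E_trans by blast
  obtain w where w: "is_glb A le (\<tau> d) y w" using up.glb_exists \<open>d \<in> A0\<close> assms in_A by metis
  have "is_glb A le (\<tau> (\<rho> y)) y y"
    using up.glb_of_le[of y "\<tau> (\<rho> y)"] up.glb_commute assms in_A \<tau>_adj down.le_refl by metis
  then have wy: "(w, y) \<in> E"
    using up.E_glb[OF w] E0_imp_\<tau>[OF dy] up.E_refl assms(1) by blast
  then have "w \<in> A" using up.E_in by blast
  have "is_glb A0 le0 d (\<rho> y) (\<rho> w)"
    using \<rho>_glb[OF w] \<open>d \<in> A0\<close> assms in_A by (simp add: \<rho>_\<tau>)
  moreover have "is_glb A0 le0 d (\<rho> y) d"
    using down.glb_of_le \<open>d \<in> A0\<close> c \<open>le0 d (\<rho> y)\<close> by blast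
  ultimately have "\<rho> w = d" using down.lmeet_eq by metis
  obtain x where x: "is_lub A le (\<sigma> c) w x" using up.lub_exists c \<open>w \<in> A\<close> in_A by metis
  have "is_lub A le (\<sigma> d) w w"
    using up.lub_of_le \<open>w \<in> A\<close> \<open>d \<in> A0\<close> in_A \<sigma>_adj \<open>\<rho> w = d\<close> down.le_refl by metis
  moreover have "(\<sigma> c, \<sigma> d) \<in> E" using dc down.E_sym E0_def by auto
  ultimately have "(x, w) \<in> E" using up.E_lub[OF x] up.E_refl \<open>w \<in> A\<close> by blast
  moreover have "is_lub A0 le0 c d (\<rho> x)"
    using \<rho>_lub[OF x] c \<open>w \<in> A\<close> in_A \<open>\<rho> w = d\<close> by (simp add: \<rho>_\<sigma>)
  moreover have "is_lub A0 le0 c d c"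
    using down.lub_of_le down.lub_commute \<open>d \<in> A0\<close> c \<open>le0 d c\<close> by blast
  ultimately have "\<rho> x = c" "(x, y) \<in> E" "x \<in> A"
    using down.ljoin_eq up.E_trans up.E_in wy by metis+
  then show ?thesis using that by blast
qed

definition adj :: "'b set \<Rightarrow> 'b set \<Rightarrow> bool" where
  "adj X Y \<longleftrightarrow> covers_in (A // E) (quot_le le) X Y \<or> covers_in (A // E) (quot_le le) Y X"

text \<open>Climb the fibre from its bottom. The step from the predecessor u of x to x either stays
  in one class or is a cover of classes: by monotonicity of \<rho>, whatever lies between u and x is
  in the same fibre, hence is u or x.\<close>

lemma fibre_path_upto:
  assumes "x \<in> A"
  shows "\<exists>p. p \<noteq> [] \<and> distinct p \<and> successively adj p \<and> hd p = E `` {\<sigma> (\<rho> x)} \<and> last p = E `` {x} \<and>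
    set p = (\<lambda>y. E `` {y}) ` {y\<in>A. \<rho> y = \<rho> x \<and> le y x}"
  using assms
proof (induction "card {y\<in>A. \<rho> y = \<rho> x \<and> le y x}" arbitrary: x rule: less_induct)
  case less
  \<comment> \<open>The position of z in its fibre; maximising it over \<open>M\<close> picks the
    immediate predecessor of x.\<close>
  define key where "key z = card {y\<in>A. \<rho> y = \<rho> z \<and> le y z}" for z
  have key_less: "key y < key z" if "y \<in> A" "z \<in> A" "\<rho> y = \<rho> z" "le y z" "y \<noteq> z" for y z
    unfolding key_def
  proof (rule psubset_card_mono)
    have "z \<notin> {w\<in>A. \<rho> w = \<rho> y \<and> le w y}" "z \<in> {y\<in>A. \<rho> y = \<rho> z \<and> le y z}"
      using up.le_antisym[of y z] that up.le_refl by auto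
    moreover have "{w\<in>A. \<rho> w = \<rho> y \<and> le w y} \<subseteq> {y\<in>A. \<rho> y = \<rho> z \<and> le y z}"
      using that by (auto intro: up.le_trans[of _ y z])
    ultimately show "{w\<in>A. \<rho> w = \<rho> y \<and> le w y} \<subset> {y\<in>A. \<rho> y = \<rho> z \<and> le y z}" by blast
  qed (simp add: finite)
  have \<sigma>_le: "le (\<sigma> (\<rho> x)) x" using less.prems in_A \<sigma>_adj down.le_refl by simp
  define M where "M = {y\<in>A. \<rho> y = \<rho> x \<and> le y x \<and> y \<noteq> x}"
  have "finite M" by (simp add: M_def finite)
  show ?case
  proof (cases "M = {}")
    case True
    then have "{y\<in>A. \<rho> y = \<rho> x \<and> le y x} = {x}" using less.prems up.le_refl by (auto simp: M_def)
    moreover have "\<sigma> (\<rho> x) = x"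
      using True \<sigma>_le less.prems in_A \<rho>_\<sigma> by (auto simp: M_def)
    ultimately show ?thesis by (intro exI[of _ "[E `` {x}]"]) simp
  next
    case False
    then have "Max (key ` M) \<in> key ` M" using \<open>finite M\<close> by simp
    then obtain u where u: "u \<in> M" "key u = Max (key ` M)" by auto
    then have uA: "u \<in> A" "\<rho> u = \<rho> x" "le u x" "u \<noteq> x" by (auto simp: M_def)
    have below: "le y u" if "y \<in> M" for y
    proof (rule ccontr)
      assume n: "\<not> le y u"
      then have "le u y" "u \<noteq> y" using chain[of u y] that uA up.le_refl by (auto simp: M_def)
      then have "key u < key y" using key_less[of u y] that uA by (auto simp: M_def)
      then show False using u(2) \<open>finite M\<close> that by (metis Max_ge finite_imageI imageI not_le)
    qed
    then have set_eq: "{y\<in>A. \<rho> y = \<rho> x \<and> le y x} = insert x {y\<in>A. \<rho> y = \<rho> u \<and> le y u}"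
      using uA less.prems up.le_refl up.le_trans[of _ u x] by (auto simp: M_def)
    have "key u < key x" using key_less uA less.prems by blast
    then obtain p where p: "p \<noteq> []" "distinct p" "successively adj p" "hd p = E `` {\<sigma> (\<rho> u)}"
        "last p = E `` {u}" "set p = (\<lambda>y. E `` {y}) ` {y\<in>A. \<rho> y = \<rho> u \<and> le y u}"
      using less.hyps[of u] uA(1) by (auto simp: key_def)
    show ?thesis
    proof (cases "(u, x) \<in> E")
      case True
      then have "E `` {x} = E `` {u}" using up.class_eq uA less.prems by blast
      then have "set p = (\<lambda>y. E `` {y}) ` {y\<in>A. \<rho> y = \<rho> x \<and> le y x}"
        unfolding set_eq p(6) using up.le_refl uA by auto
      then show ?thesis using p uA \<open>E `` {x} = E `` {u}\<close> by auto
    next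
      case False
      have "covers_in (A // E) (quot_le le) (E `` {u}) (E `` {x})"
      proof (rule up.covers_in_quotient)
        fix z assume z: "z \<in> A" "le u z" "le z x"
        then have "le0 (\<rho> x) (\<rho> z)" "le0 (\<rho> z) (\<rho> x)"
          using \<rho>_mono uA less.prems by metis+
        then have "\<rho> z = \<rho> x" using down.le_antisym z less.prems in_A by blast
        then have "z = x \<or> z = u"
          using below[of z] z uA up.le_antisym[of z u] by (auto simp: M_def)
        then show "(z, u) \<in> E \<or> (z, x) \<in> E" using up.E_refl z by blast
      qed (use uA less.prems False in auto)
      then have "adj (last p) (E `` {x})" by (simp add: adj_def p)
      moreover have "E `` {x} \<notin> set p"
      proof
        \<comment> \<open>Classes are convex, so a class once left while climbing the chain cannot
          recur.\<close>
        assume "E `` {x} \<in> set p"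
        then obtain y where y: "y \<in> A" "le y u" "(y, x) \<in> E"
          using p(6) up.class_eq less.prems up.E_sym by auto
        then show False using up.E_convex uA False by blast
      qed
      moreover have "set (p @ [E `` {x}]) = (\<lambda>y. E `` {y}) ` {y\<in>A. \<rho> y = \<rho> x \<and> le y x}"
        unfolding set_eq using p(6) by auto
      ultimately show ?thesis
        using p uA by (intro exI[of _ "p @ [E `` {x}]"]) (auto simp: successively_append_iff)
    qed
  qed
qed

lemma fibre_path:
  assumes "c \<in> A0"
  shows "\<exists>p. p \<noteq> [] \<and> distinct p \<and> successively adj p \<and> hd p = E `` {\<sigma> c} \<and> last p = E `` {\<tau> c} \<and>
    set p = (\<lambda>y. E `` {y}) ` {y\<in>A. \<rho> y = c}"
proof -
  have "{y\<in>A. \<rho> y = c \<and> le y (\<tau> c)} = {y\<in>A. \<rho> y = c}"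
    using assms \<tau>_adj down.le_refl by auto
  then show ?thesis using fibre_path_upto[of "\<tau> c"] assms in_A by (simp add: \<rho>_\<tau>)
qed

text \<open>Choose comparable representatives c' and d' of the two classes. As the image of \<sigma>
  is down-closed, the interval from \<open>\<sigma> c'\<close> to \<open>\<sigma> d'\<close>
  consists of \<sigma>-images of elements between c' and d', so \<open>covers_in_quotient\<close>
  applies. Up-closedness of the image of \<tau> gives the second claim.\<close>

lemma rungs:
  assumes "covers_in (A0 // E0) (quot_le le0) (E0 `` {c}) (E0 `` {d})" "c \<in> A0" "d \<in> A0"
  shows "covers_in (A // E) (quot_le le) (E `` {\<sigma> c}) (E `` {\<sigma> d})"
    and "covers_in (A // E) (quot_le le) (E `` {\<tau> c}) (E `` {\<tau> d})"
proof -
  have "quot_le le0 (E0 `` {c}) (E0 `` {d})" using assms(1) by (simp add: covers_in_def)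
  then obtain c' d' where cd: "(c, c') \<in> E0" "(d, d') \<in> E0" "le0 c' d'" by (auto simp: quot_le_def)
  then have A0: "c' \<in> A0" "d' \<in> A0" using down.E_in by blast+
  have ne: "(c', d') \<notin> E0"
  proof
    assume "(c', d') \<in> E0"
    then have "(c, d) \<in> E0" using cd down.E_sym down.E_trans by metis
    then have "E0 `` {c} = E0 `` {d}" using down.class_eq assms by simp
    then show False using assms(1) by (simp add: covers_in_def)
  qed
  have between: "(e, c') \<in> E0 \<or> (e, d') \<in> E0" if "e \<in> A0" "le0 c' e" "le0 e d'" for e
  proof -
    have "E0 `` {e} \<in> A0 // E0" using that by (simp add: quotientI)
    moreover have "quot_le le0 (E0 `` {c}) (E0 `` {e})" "quot_le le0 (E0 `` {e}) (E0 `` {d})"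
      using that cd down.E_refl by (auto simp: quot_le_def)
    ultimately have "E0 `` {e} = E0 `` {c} \<or> E0 `` {e} = E0 `` {d}"
      using assms(1) unfolding covers_in_def by blast
    then have "(e, c) \<in> E0 \<or> (e, d) \<in> E0" using down.class_eq that assms by simp
    then show ?thesis using cd down.E_trans by metis
  qed
  have cov: "covers_in (A // E) (quot_le le) (E `` {\<sigma> c'}) (E `` {\<sigma> d'})"
  proof (rule up.covers_in_quotient)
    fix z assume z: "z \<in> A" "le (\<sigma> c') z" "le z (\<sigma> d')"
    then have "\<sigma> (\<rho> z) = z" using \<sigma>_down A0 by blast
    moreover have "le0 c' (\<rho> z)" using \<sigma>_adj z A0 by blast
    moreover have "le0 (\<rho> z) d'" using \<rho>_mono z A0 in_A \<rho>_\<sigma> by metis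
    ultimately show "(z, \<sigma> c') \<in> E \<or> (z, \<sigma> d') \<in> E"
      using between z in_A A0 by (metis E0_iff)
  qed (use A0 in_A \<sigma>_mono cd ne in \<open>auto simp: E0_iff\<close>)
  have "E `` {\<sigma> c} = E `` {\<sigma> c'}" "E `` {\<sigma> d} = E `` {\<sigma> d'}"
    using cd E0_iff A0 assms up.class_eq in_A by metis+
  with cov show "covers_in (A // E) (quot_le le) (E `` {\<sigma> c}) (E `` {\<sigma> d})" by simp
  have cov: "covers_in (A // E) (quot_le le) (E `` {\<tau> c'}) (E `` {\<tau> d'})"
  proof (rule up.covers_in_quotient)
    fix z assume z: "z \<in> A" "le (\<tau> c') z" "le z (\<tau> d')"
    then have "\<tau> (\<rho> z) = z" using \<tau>_up A0 by blast
    moreover have "le0 (\<rho> z) d'" using \<tau>_adj z A0 by blast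
    moreover have "le0 c' (\<rho> z)" using \<rho>_mono z A0 in_A \<rho>_\<tau> by metis
    ultimately show "(z, \<tau> c') \<in> E \<or> (z, \<tau> d') \<in> E"
      using between z in_A A0 by (metis E0_imp_\<tau>)
  next
    show "(\<tau> c', \<tau> d') \<notin> E" using E_imp_E0[of "\<tau> c'" "\<tau> d'"] ne A0 by (auto simp: \<rho>_\<tau>)
  qed (use A0 in_A \<tau>_mono cd in auto)
  have "E `` {\<tau> c} = E `` {\<tau> c'}" "E `` {\<tau> d} = E `` {\<tau> d'}"
    using cd E0_imp_\<tau> A0 assms up.class_eq in_A by metis+
  with cov show "covers_in (A // E) (quot_le le) (E `` {\<tau> c}) (E `` {\<tau> d})" by simp
qed

lemma ham_path_lift:
  assumes "cover_graph_ham_path (A0 // E0) (quot_le le0)"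
  shows "cover_graph_ham_path (A // E) (quot_le le)"
proof (cases "A0 = {}")
  case True
  then have "A = {}" using \<rho>_in by auto
  then show ?thesis by (simp add: cover_graph_ham_path_def)
next
  case False
  obtain Xs where Xs: "distinct Xs" "set Xs = A0 // E0"
    "successively (\<lambda>X Y. covers_in (A0 // E0) (quot_le le0) X Y \<or> covers_in (A0 // E0) (quot_le le0) Y X) Xs"
    using assms unfolding cover_graph_ham_path_def by (auto simp: successively_conv_nth)
  \<comment> \<open>One representative per class suffices: by \<open>fibre_meets_class\<close>, the
    fibre over any other member of the class meets the same classes of \<open>E\<close>.\<close>
  define c where "c X = (SOME c. c \<in> A0 \<and> E0 `` {c} = X)" for X
  have c: "c X \<in> A0" "E0 `` {c X} = X" if "X \<in> set Xs" for X
  proof -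
    have "\<exists>c. c \<in> A0 \<and> E0 `` {c} = X" using that Xs(2) by (auto elim: quotientE)
    from someI_ex[OF this] show "c X \<in> A0" "E0 `` {c X} = X" by (simp_all add: c_def)
  qed
  define p where "p X = (SOME p. p \<noteq> [] \<and> distinct p \<and> successively adj p \<and> hd p = E `` {\<sigma> (c X)} \<and>
      last p = E `` {\<tau> (c X)} \<and> set p = (\<lambda>y. E `` {y}) ` {y\<in>A. \<rho> y = c X})" for X
  have p: "p X \<noteq> []" "distinct (p X)" "successively adj (p X)" "hd (p X) = E `` {\<sigma> (c X)}"
      "last (p X) = E `` {\<tau> (c X)}" "set (p X) = (\<lambda>y. E `` {y}) ` {y\<in>A. \<rho> y = c X}"
    if "X \<in> set Xs" for X
    using someI_ex[OF fibre_path[OF c(1)[OF that]]] by (simp_all add: p_def)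
  have "\<exists>q. q \<noteq> [] \<and> distinct q \<and> successively adj q \<and> set q = (\<Union>X\<in>set Xs. set (p X)) \<and>
             hd q = (if True then hd (p (hd Xs)) else last (p (hd Xs)))"
  proof (rule zigzag_path)
    show "adj y x" if "adj x y" for x y using that by (auto simp: adj_def)
    show "Xs \<noteq> []" using False Xs(2) by (metis empty_set quotient_is_empty)
    show "p X \<noteq> [] \<and> distinct (p X) \<and> successively adj (p X)" if "X \<in> set Xs" for X
      using p[OF that] by simp
    show "set (p X) \<inter> set (p Y) = {}" if XY: "X \<in> set Xs" "Y \<in> set Xs" "X \<noteq> Y" for X Y
    proof (rule ccontr)
      assume "set (p X) \<inter> set (p Y) \<noteq> {}"
      then obtain Z where "Z \<in> set (p X)" "Z \<in> set (p Y)" by blast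
      then obtain x y where xy: "x \<in> A" "y \<in> A" "\<rho> x = c X" "\<rho> y = c Y" "E `` {x} = E `` {y}"
        unfolding p(6)[OF XY(1)] p(6)[OF XY(2)] by auto
      then have "(c X, c Y) \<in> E0" using E_imp_E0[of x y] up.class_eq by simp
      then have "E0 `` {c X} = E0 `` {c Y}" using down.class_eq c(1) XY by simp
      then show False using XY c(2) by simp
    qed
    show "successively (\<lambda>X Y. adj (hd (p X)) (hd (p Y)) \<and> adj (last (p X)) (last (p Y))) Xs"
    proof (rule successively_mono[OF Xs(3)])
      fix X Y assume XY: "X \<in> set Xs" "Y \<in> set Xs"
        and cov: "covers_in (A0 // E0) (quot_le le0) X Y \<or> covers_in (A0 // E0) (quot_le le0) Y X"
      then show "adj (hd (p X)) (hd (p Y)) \<and> adj (last (p X)) (last (p Y))"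
        using rungs[of "c X" "c Y"] rungs[of "c Y" "c X"] by (auto simp: adj_def c p)
    qed
  qed (use Xs in simp)
  then obtain q where q: "distinct q" "successively adj q" "set q = (\<Union>X\<in>set Xs. set (p X))" by blast
  have "set q = A // E"
  proof
    show "set q \<subseteq> A // E"
      using q(3) by (auto simp: p(6) quotientI)
    show "A // E \<subseteq> set q"
    proof
      fix Y assume "Y \<in> A // E"
      then obtain y where y: "y \<in> A" "Y = E `` {y}" by (auto elim: quotientE)
      define X where "X = E0 `` {\<rho> y}"
      have X: "X \<in> set Xs" using y in_A Xs(2) by (simp add: X_def quotientI)
      then have "(c X, \<rho> y) \<in> E0" using c[OF X] down.class_eq[of "c X" "\<rho> y"] y in_A by (simp add: X_def)
      then obtain x where "x \<in> A" "\<rho> x = c X" "(x, y) \<in> E" using fibre_meets_class[OF y(1)] by blast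
      then have "Y \<in> set (p X)" using y up.class_eq by (auto simp: p(6)[OF X])
      then show "Y \<in> set q" using q(3) X by auto
    qed
  qed
  then show ?thesis
    using q unfolding cover_graph_ham_path_def
    by (intro exI[of _ q]) (auto simp: successively_conv_nth adj_def)
qed

end

text \<open>The two claims are bundled to form the induction statement: the lattice property of the
  base is needed to prove that of the extension.\<close>

definition hamiltonian_quotients :: "'b set \<Rightarrow> ('b \<Rightarrow> 'b \<Rightarrow> bool) \<Rightarrow> bool" where
  "hamiltonian_quotients A le \<longleftrightarrow> lattice_on A le \<and>
     (\<forall>E. lattice_congruence A le E \<longrightarrow> cover_graph_ham_path (A // E) (quot_le le))"

lemma (in chain_fibration) hamiltonian_quotients_lift:
  assumes "hamiltonian_quotients A0 le0"
  shows "hamiltonian_quotients A le"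
  unfolding hamiltonian_quotients_def
proof (intro conjI allI impI)
  show "lattice_on A le" by (rule up.lattice)
  fix E assume "lattice_congruence A le E"
  then interpret quotient_fibration A le A0 le0 \<rho> \<sigma> \<tau> E by unfold_locales
  show "cover_graph_ham_path (A // E) (quot_le le)"
    using assms E0_congruence by (intro ham_path_lift) (auto simp: hamiltonian_quotients_def)
qed

section \<open>Families of sets extended by chains\<close>

text \<open>In the axiom \<open>flip\<close>, the element \<open>h\<close> decides which of \<open>s\<close> and \<open>t\<close> is acquired first
  along the fibres.\<close>

locale chain_extension =
  fixes A :: "'b set" and le :: "'b \<Rightarrow> 'b \<Rightarrow> bool" and inv :: "'b \<Rightarrow> 'h set"
    and A0 :: "'c set" and le0 :: "'c \<Rightarrow> 'c \<Rightarrow> bool" and inv0 :: "'c \<Rightarrow> 'h set"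
    and \<rho> :: "'b \<Rightarrow> 'c" and H0 H1 :: "'h set"
  assumes finite_A: "finite A" and finite_H1: "finite H1" and disjoint: "H0 \<inter> H1 = {}"
    and le_iff: "x \<in> A \<Longrightarrow> y \<in> A \<Longrightarrow> le x y \<longleftrightarrow> inv x \<subseteq> inv y"
    and inj_inv: "inj_on inv A" and inv_subset: "x \<in> A \<Longrightarrow> inv x \<subseteq> H0 \<union> H1"
    and le0_iff: "c \<in> A0 \<Longrightarrow> d \<in> A0 \<Longrightarrow> le0 c d \<longleftrightarrow> inv0 c \<subseteq> inv0 d"
    and inj_inv0: "inj_on inv0 A0"
    and \<rho>_image: "\<rho> ` A = A0" and inv0_\<rho>: "x \<in> A \<Longrightarrow> inv0 (\<rho> x) = inv x \<inter> H0"
    and flip: "s \<in> H1 \<Longrightarrow> t \<in> H1 \<Longrightarrow> s \<noteq> t \<Longrightarrow> \<exists>h\<in>H0.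
      (\<forall>x\<in>A. (h \<in> inv x \<longrightarrow> s \<in> inv x \<longrightarrow> t \<in> inv x) \<and> (h \<notin> inv x \<longrightarrow> t \<in> inv x \<longrightarrow> s \<in> inv x)) \<or>
      (\<forall>x\<in>A. (h \<in> inv x \<longrightarrow> t \<in> inv x \<longrightarrow> s \<in> inv x) \<and> (h \<notin> inv x \<longrightarrow> s \<in> inv x \<longrightarrow> t \<in> inv x))"
    and insertion: "c \<in> A0 \<Longrightarrow> t \<in> H1 \<Longrightarrow>
      \<exists>x\<in>A. \<exists>y\<in>A. \<rho> x = c \<and> t \<notin> inv x \<and> inv y = insert t (inv x)"
begin

lemma \<rho>_in: "x \<in> A \<Longrightarrow> \<rho> x \<in> A0"
  using \<rho>_image by blast

lemma fibre_nonempty: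
  assumes "c \<in> A0"
  obtains x where "x \<in> A" "\<rho> x = c"
  using assms \<rho>_image by blast

lemma \<rho>_eq_iff: "x \<in> A \<Longrightarrow> y \<in> A \<Longrightarrow> \<rho> x = \<rho> y \<longleftrightarrow> inv x \<inter> H0 = inv y \<inter> H0"
  using inj_inv0 \<rho>_in inv0_\<rho> by (metis inj_onD)

lemma insertion_fibre:
  assumes "c \<in> A0" "t \<in> H1"
  obtains x y where "x \<in> A" "y \<in> A" "\<rho> x = c" "\<rho> y = c" "t \<notin> inv x" "inv y = insert t (inv x)"
proof -
  obtain x y where xy: "x \<in> A" "y \<in> A" "\<rho> x = c" "t \<notin> inv x" "inv y = insert t (inv x)"
    using insertion assms by blast
  then have "\<rho> y = \<rho> x" using \<rho>_eq_iff assms disjoint by auto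
  then show ?thesis using that xy by blast
qed

text \<open>Incomparable members of a fibre would acquire some s and t in opposite orders, although
  they agree on the element h that dictates this order.\<close>

lemma fibre_chain:
  assumes "x \<in> A" "y \<in> A" "\<rho> x = \<rho> y"
  shows "inv x \<subseteq> inv y \<or> inv y \<subseteq> inv x"
proof (rule ccontr)
  assume "\<not> ?thesis"
  then obtain s t where st: "s \<in> inv x" "s \<notin> inv y" "t \<in> inv y" "t \<notin> inv x" by blast
  have eq: "inv x \<inter> H0 = inv y \<inter> H0" using assms \<rho>_eq_iff by blast
  then have "s \<in> H1" "t \<in> H1" "s \<noteq> t" using st assms inv_subset by blast+
  then obtain h where "h \<in> H0" "(\<forall>x\<in>A. (h \<in> inv x \<longrightarrow> s \<in> inv x \<longrightarrow> t \<in> inv x) \<and> (h \<notin> inv x \<longrightarrow> t \<in> inv x \<longrightarrow> s \<in> inv x)) \<or>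
      (\<forall>x\<in>A. (h \<in> inv x \<longrightarrow> t \<in> inv x \<longrightarrow> s \<in> inv x) \<and> (h \<notin> inv x \<longrightarrow> s \<in> inv x \<longrightarrow> t \<in> inv x))"
    using flip by blast
  then show False using st eq assms by blast
qed

text \<open>In a chain an element with the fewest members of \<open>H1\<close> is least. The
  predicate \<open>P\<close> allows constrained choices: it is trivial for bottom sections and
  prescribes a subset of \<open>H1\<close> for joins.\<close>

lemma least_in_fibre:
  assumes x: "x \<in> A" "\<rho> x = c" "P x"
  shows "\<exists>z\<in>A. \<rho> z = c \<and> P z \<and> (\<forall>y\<in>A. \<rho> y = c \<longrightarrow> P y \<longrightarrow> inv z \<subseteq> inv y)"
proof -
  obtain z where z: "z \<in> A \<and> \<rho> z = c \<and> P z"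
    "\<And>y. y \<in> A \<and> \<rho> y = c \<and> P y \<Longrightarrow> card (inv z \<inter> H1) \<le> card (inv y \<inter> H1)"
    using ex_has_least_nat[of "\<lambda>x. x \<in> A \<and> \<rho> x = c \<and> P x" x "\<lambda>x. card (inv x \<inter> H1)"] x by blast
  have "inv z \<subseteq> inv y" if y: "y \<in> A" "\<rho> y = c" "P y" for y
  proof (rule ccontr)
    assume n: "\<not> inv z \<subseteq> inv y"
    then have "inv y \<subseteq> inv z" using fibre_chain y z by blast
    moreover have "inv y \<inter> H0 = inv z \<inter> H0" using y z \<rho>_eq_iff by blast
    ultimately have "inv y \<inter> H1 \<subset> inv z \<inter> H1"
      using n y z inv_subset[of z] by blast
    then have "card (inv y \<inter> H1) < card (inv z \<inter> H1)"
      using finite_H1 by (intro psubset_card_mono) auto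
    then show False using z(2) y by fastforce
  qed
  then show ?thesis using z by blast
qed

lemma greatest_in_fibre:
  assumes x: "x \<in> A" "\<rho> x = c" "P x"
  shows "\<exists>z\<in>A. \<rho> z = c \<and> P z \<and> (\<forall>y\<in>A. \<rho> y = c \<longrightarrow> P y \<longrightarrow> inv y \<subseteq> inv z)"
proof -
  obtain z where z: "z \<in> A \<and> \<rho> z = c \<and> P z"
    "\<And>y. y \<in> A \<and> \<rho> y = c \<and> P y \<Longrightarrow> card (H1 - inv z) \<le> card (H1 - inv y)"
    using ex_has_least_nat[of "\<lambda>x. x \<in> A \<and> \<rho> x = c \<and> P x" x "\<lambda>x. card (H1 - inv x)"] x by blast
  have "inv y \<subseteq> inv z" if y: "y \<in> A" "\<rho> y = c" "P y" for y
  proof (rule ccontr)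
    assume n: "\<not> inv y \<subseteq> inv z"
    then have "inv z \<subseteq> inv y" using fibre_chain y z by blast
    moreover have "inv y \<inter> H0 = inv z \<inter> H0" using y z \<rho>_eq_iff by blast
    ultimately have "H1 - inv y \<subset> H1 - inv z"
      using n y z inv_subset[of y] by blast
    then have "card (H1 - inv y) < card (H1 - inv z)"
      using finite_H1 by (intro psubset_card_mono) auto
    then show False using z(2) y by fastforce
  qed
  then show ?thesis using z by blast
qed

text \<open>For each t in \<open>H1\<close>, \<open>insertion\<close> provides a fibre member
  lacking t; the least member lies below all of these and so lacks every t.\<close>

lemma bottom_section:
  assumes "c \<in> A0"
  obtains x where "x \<in> A" "\<rho> x = c" "inv x = inv0 c"
proof -
  obtain x0 where x0: "x0 \<in> A" "\<rho> x0 = c" using fibre_nonempty assms by blast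
  obtain x where x: "x \<in> A" "\<rho> x = c" "\<And>y. y \<in> A \<Longrightarrow> \<rho> y = c \<Longrightarrow> inv x \<subseteq> inv y"
    using least_in_fibre[of x0 c "\<lambda>_. True", OF x0 TrueI] by auto
  have "t \<notin> inv x" if "t \<in> H1" for t
    using insertion_fibre[OF assms that] x(3) by (metis insertI1 subsetD)
  then have "inv x = inv0 c" using inv_subset[of x] inv0_\<rho>[of x] x by blast
  then show ?thesis using that x by blast
qed

lemma top_section:
  assumes "c \<in> A0"
  obtains x where "x \<in> A" "\<rho> x = c" "inv x = inv0 c \<union> H1"
proof -
  obtain x0 where x0: "x0 \<in> A" "\<rho> x0 = c" using fibre_nonempty assms by blast
  obtain x where x: "x \<in> A" "\<rho> x = c" "\<And>y. y \<in> A \<Longrightarrow> \<rho> y = c \<Longrightarrow> inv y \<subseteq> inv x"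
    using greatest_in_fibre[of x0 c "\<lambda>_. True", OF x0 TrueI] by auto
  have "t \<in> inv x" if "t \<in> H1" for t
    using insertion_fibre[OF assms that] x(3) by (metis insertI1 subsetD)
  then have "inv x = inv0 c \<union> H1" using inv_subset[of x] inv0_\<rho>[of x] x by blast
  then show ?thesis using that x by blast
qed

text \<open>The candidate z is the least element over e containing \<open>S\<close>. If an upper
  bound w missed some t of z in \<open>H1\<close>, take v and v' over e such that v' is v with t
  added. It turns out that v already contains \<open>S\<close>, so z lies below v, which lacks t: a
  contradiction.\<close>

lemma lub_lift:
  assumes A: "x \<in> A" "y \<in> A" and e: "is_lub A0 le0 (\<rho> x) (\<rho> y) e"
  shows "\<exists>z. is_lub A le x y z"
proof -
  define S where "S = (inv x \<union> inv y) \<inter> H1"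
  have "e \<in> A0" "le0 (\<rho> x) e" "le0 (\<rho> y) e" using e by (auto simp: is_lub_def)
  then have He: "inv x \<inter> H0 \<subseteq> inv0 e" "inv y \<inter> H0 \<subseteq> inv0 e"
    using A \<rho>_in le0_iff inv0_\<rho> by auto
  obtain z0 where z0: "z0 \<in> A" "\<rho> z0 = e" "inv z0 = inv0 e \<union> H1" using top_section \<open>e \<in> A0\<close> .
  then have "S \<subseteq> inv z0" by (auto simp: S_def)
  obtain z where z: "z \<in> A" "\<rho> z = e" "S \<subseteq> inv z"
    "\<And>y. y \<in> A \<Longrightarrow> \<rho> y = e \<Longrightarrow> S \<subseteq> inv y \<Longrightarrow> inv z \<subseteq> inv y"
    using least_in_fibre[of z0 e "\<lambda>z. S \<subseteq> inv z", OF z0(1,2) \<open>S \<subseteq> inv z0\<close>] by auto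
  have inv_z: "inv0 e = inv z \<inter> H0" using z inv0_\<rho> by auto
  have "is_lub A le x y z"
    unfolding is_lub_def
  proof (intro conjI ballI impI)
    show "z \<in> A" by fact
    show "le x z" "le y z"
      using z A He inv_subset[of x] inv_subset[of y] inv_z by (auto simp: le_iff S_def)
    fix w assume w: "w \<in> A" "le x w \<and> le y w"
    then have xw: "inv x \<subseteq> inv w" "inv y \<subseteq> inv w" using le_iff A by auto
    have "le0 (\<rho> x) (\<rho> w)" "le0 (\<rho> y) (\<rho> w)"
      using xw A w by (auto simp: le0_iff \<rho>_in inv0_\<rho>)
    then have "le0 e (\<rho> w)" using e w \<rho>_in by (auto simp: is_lub_def)
    then have ew: "inv0 e \<subseteq> inv w" using le0_iff \<open>e \<in> A0\<close> \<rho>_in w inv0_\<rho> by auto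
    have "t \<in> inv w" if t: "t \<in> inv z" "t \<in> H1" for t
    proof (rule ccontr)
      assume tw: "t \<notin> inv w"
      obtain v v' where v: "v \<in> A" "v' \<in> A" "\<rho> v = e" "\<rho> v' = e" "t \<notin> inv v"
          "inv v' = insert t (inv v)"
        using insertion_fibre \<open>e \<in> A0\<close> t by metis
      have v'H: "inv v' \<inter> H0 = inv0 e" using v inv0_\<rho> by metis
      have "s \<in> inv v" if "s \<in> S" for s
      proof -
        have "s \<in> inv w" "s \<in> H1" "s \<noteq> t" using that xw tw by (auto simp: S_def)
        have "s \<in> inv x \<or> s \<in> inv y" using that by (auto simp: S_def)
        then obtain u where u: "u \<in> A" "s \<in> inv u" "t \<notin> inv u" "inv u \<inter> H0 \<subseteq> inv0 e"
          using xw tw A He by blast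
        obtain h where h: "h \<in> H0"
          "(\<forall>x\<in>A. (h \<in> inv x \<longrightarrow> s \<in> inv x \<longrightarrow> t \<in> inv x) \<and> (h \<notin> inv x \<longrightarrow> t \<in> inv x \<longrightarrow> s \<in> inv x)) \<or>
           (\<forall>x\<in>A. (h \<in> inv x \<longrightarrow> t \<in> inv x \<longrightarrow> s \<in> inv x) \<and> (h \<notin> inv x \<longrightarrow> s \<in> inv x \<longrightarrow> t \<in> inv x))"
          using flip[OF \<open>s \<in> H1\<close> t(2) \<open>s \<noteq> t\<close>] by blast
        \<comment> \<open>Both u and w contain s but not t, so they are on the same side of h, the
          one where t forces s. The \<open>H0\<close>-part of v' is e, which lies between those of u
          and w, hence v' is on that side too.\<close>
        have "t \<in> inv v'" using v by simp
        then have "s \<in> inv v'"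
          using h u w(1) ew tw \<open>s \<in> inv w\<close> v(2) v'H by blast
        then show ?thesis using v(6) \<open>s \<noteq> t\<close> by simp
      qed
      then have "inv z \<subseteq> inv v" using z(4)[OF v(1,3)] by blast
      then show False using t v by blast
    qed
    then show "le z w" using ew inv_z inv_subset[of z] z w by (auto simp: le_iff)
  qed
  then show ?thesis by blast
qed

lemma glb_lift:
  assumes A: "x \<in> A" "y \<in> A" and e: "is_glb A0 le0 (\<rho> x) (\<rho> y) e"
  shows "\<exists>z. is_glb A le x y z"
proof -
  \<comment> \<open>The part of \<open>H1\<close> that a lower bound must avoid; z will be the
    largest element over e avoiding it.\<close>
  define S where "S = H1 - (inv x \<inter> inv y)"
  have "e \<in> A0" "le0 e (\<rho> x)" "le0 e (\<rho> y)" using e by (auto simp: is_glb_def)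
  then have He: "inv0 e \<subseteq> inv x" "inv0 e \<subseteq> inv y"
    using A \<rho>_in le0_iff inv0_\<rho> by auto
  obtain z0 where z0: "z0 \<in> A" "\<rho> z0 = e" "inv z0 = inv0 e" using bottom_section \<open>e \<in> A0\<close> .
  then have z0S: "inv z0 \<inter> S = {}" using He by (auto simp: S_def)
  obtain z where z: "z \<in> A" "\<rho> z = e" "inv z \<inter> S = {}"
    "\<And>y. y \<in> A \<Longrightarrow> \<rho> y = e \<Longrightarrow> inv y \<inter> S = {} \<Longrightarrow> inv y \<subseteq> inv z"
    using greatest_in_fibre[of z0 e "\<lambda>z. inv z \<inter> S = {}", OF z0(1,2) z0S] by auto
  have inv_z: "inv0 e = inv z \<inter> H0" using z inv0_\<rho> by auto
  have "is_glb A le x y z"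
    unfolding is_glb_def
  proof (intro conjI ballI impI)
    show "z \<in> A" by fact
    show "le z x" "le z y"
      using z A He inv_subset[of z] inv_z by (auto simp: le_iff S_def)
    fix w assume w: "w \<in> A" "le w x \<and> le w y"
    then have xw: "inv w \<subseteq> inv x" "inv w \<subseteq> inv y" using le_iff A by auto
    have "le0 (\<rho> w) (\<rho> x)" "le0 (\<rho> w) (\<rho> y)"
      using xw A w by (auto simp: le0_iff \<rho>_in inv0_\<rho>)
    then have "le0 (\<rho> w) e" using e w \<rho>_in by (auto simp: is_glb_def)
    then have ew: "inv w \<inter> H0 \<subseteq> inv0 e" using le0_iff \<open>e \<in> A0\<close> \<rho>_in w inv0_\<rho> by auto
    have "t \<in> inv z" if t: "t \<in> inv w" "t \<in> H1" for t
    proof (rule ccontr)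
      assume tz: "t \<notin> inv z"
      obtain v v' where v: "v \<in> A" "v' \<in> A" "\<rho> v = e" "\<rho> v' = e" "t \<notin> inv v"
          "inv v' = insert t (inv v)"
        using insertion_fibre \<open>e \<in> A0\<close> t by metis
      have vH: "inv v \<inter> H0 = inv0 e" using v inv0_\<rho> by metis
      have "t \<notin> S" using xw t by (auto simp: S_def)
      have "s \<notin> inv v" if "s \<in> S" for s
      proof
        assume sv: "s \<in> inv v"
        have "s \<notin> inv w" "s \<in> H1" "s \<noteq> t" using that xw \<open>t \<notin> S\<close> by (auto simp: S_def)
        have "s \<notin> inv x \<or> s \<notin> inv y" using that by (auto simp: S_def)
        then obtain u where u: "u \<in> A" "s \<notin> inv u" "t \<in> inv u" "inv0 e \<subseteq> inv u"
          using xw t A He by blast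
        obtain h where h: "h \<in> H0"
          "(\<forall>x\<in>A. (h \<in> inv x \<longrightarrow> s \<in> inv x \<longrightarrow> t \<in> inv x) \<and> (h \<notin> inv x \<longrightarrow> t \<in> inv x \<longrightarrow> s \<in> inv x)) \<or>
           (\<forall>x\<in>A. (h \<in> inv x \<longrightarrow> t \<in> inv x \<longrightarrow> s \<in> inv x) \<and> (h \<notin> inv x \<longrightarrow> s \<in> inv x \<longrightarrow> t \<in> inv x))"
          using flip[OF \<open>s \<in> H1\<close> t(2) \<open>s \<noteq> t\<close>] by blast
        \<comment> \<open>Dually, w and u contain t but not s, and the \<open>H0\<close>-part of v
          lies between theirs, so s would force t in v.\<close>
        have "t \<in> inv v"
          using h u w(1) ew t \<open>s \<notin> inv w\<close> v(1) vH sv by blast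
        then show False using v(5) by simp
      qed
      then have "inv v' \<inter> S = {}" using v(6) \<open>t \<notin> S\<close> by auto
      then have "inv v' \<subseteq> inv z" using z(4)[OF v(2,4)] by blast
      then show False using tz v(6) by blast
    qed
    then show "le w z" using ew inv_z inv_subset[of w] z w by (auto simp: le_iff)
  qed
  then show ?thesis by blast
qed

lemma lattice_lift:
  assumes "lattice_on A0 le0"
  shows "lattice_on A le"
  unfolding lattice_on_def partial_order_on_rel_def
proof (intro conjI ballI impI)
  fix x y assume A: "x \<in> A" "y \<in> A"
  then have "\<rho> x \<in> A0" "\<rho> y \<in> A0" by (auto simp: \<rho>_in)
  then obtain j m where "is_lub A0 le0 (\<rho> x) (\<rho> y) j" "is_glb A0 le0 (\<rho> x) (\<rho> y) m"
    using assms unfolding lattice_on_def by metis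
  then show "\<exists>z. is_lub A le x y z" "\<exists>z. is_glb A le x y z"
    using A lub_lift glb_lift by blast+
  show "x = y" if "le x y \<and> le y x"
    using that A le_iff inj_inv by (metis inj_onD subset_antisym)
next
  fix x y z assume "x \<in> A" "y \<in> A" "z \<in> A" "le x y \<and> le y z"
  then show "le x z" using le_iff by (metis subset_trans)
qed (simp add: le_iff)

theorem hamiltonian_quotients_extension:
  assumes "hamiltonian_quotients A0 le0"
  shows "hamiltonian_quotients A le"
proof -
  define \<sigma> where "\<sigma> c = (SOME x. x \<in> A \<and> \<rho> x = c \<and> inv x = inv0 c)" for c
  define \<tau> where "\<tau> c = (SOME x. x \<in> A \<and> \<rho> x = c \<and> inv x = inv0 c \<union> H1)" for c
  have \<sigma>: "\<sigma> c \<in> A" "\<rho> (\<sigma> c) = c" "inv (\<sigma> c) = inv0 c" if "c \<in> A0" for c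
  proof -
    have "\<exists>x. x \<in> A \<and> \<rho> x = c \<and> inv x = inv0 c" using bottom_section[OF that] by blast
    from someI_ex[OF this] show "\<sigma> c \<in> A" "\<rho> (\<sigma> c) = c" "inv (\<sigma> c) = inv0 c"
      by (simp_all add: \<sigma>_def)
  qed
  have \<tau>: "\<tau> c \<in> A" "\<rho> (\<tau> c) = c" "inv (\<tau> c) = inv0 c \<union> H1" if "c \<in> A0" for c
  proof -
    have "\<exists>x. x \<in> A \<and> \<rho> x = c \<and> inv x = inv0 c \<union> H1" using top_section[OF that] by blast
    from someI_ex[OF this] show "\<tau> c \<in> A" "\<rho> (\<tau> c) = c" "inv (\<tau> c) = inv0 c \<union> H1"
      by (simp_all add: \<tau>_def)
  qed
  have inv0_sub: "inv0 c \<subseteq> H0" if "c \<in> A0" for c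
    using inv0_\<rho>[OF \<sigma>(1)[OF that]] \<sigma>(2)[OF that] by simp
  have "lattice_on A0 le0" using assms by (simp add: hamiltonian_quotients_def)
  interpret chain_fibration A le A0 le0 \<rho> \<sigma> \<tau>
  proof
    show "lattice_on A le" using lattice_lift \<open>lattice_on A0 le0\<close> .
    show "lattice_on A0 le0" by fact
    show "finite A" by (rule finite_A)
    show "le x y \<or> le y x" if "x \<in> A" "y \<in> A" "\<rho> x = \<rho> y" for x y
      using fibre_chain that le_iff by blast
    fix c x assume cx: "c \<in> A0" "x \<in> A"
    show "le (\<sigma> c) x = le0 c (\<rho> x)"
      using cx \<sigma> \<rho>_in inv0_\<rho> inv0_sub by (simp add: le_iff le0_iff)
    show "le x (\<tau> c) = le0 (\<rho> x) c"
    proof -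
      \<comment> \<open>The top section contains all of \<open>H1\<close>, so only the
        \<open>H0\<close>-part is constrained.\<close>
      have "inv x \<subseteq> inv0 c \<union> H1 \<longleftrightarrow> inv x \<inter> H0 \<subseteq> inv0 c"
        using inv_subset[OF cx(2)] disjoint by blast
      then show ?thesis using cx \<tau> \<rho>_in inv0_\<rho> by (simp add: le_iff le0_iff)
    qed
    show "\<sigma> (\<rho> x) = x" if "le x (\<sigma> c)"
    proof (rule inj_onD[OF inj_inv])
      show "inv (\<sigma> (\<rho> x)) = inv x"
      proof -
        have "inv x \<subseteq> inv0 c" using that cx \<sigma> by (simp add: le_iff)
        then show ?thesis
          using inv0_sub[OF cx(1)] \<sigma>(3)[OF \<rho>_in[OF cx(2)]] inv0_\<rho>[OF cx(2)] by auto
      qed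
    qed (use cx \<sigma> \<rho>_in in auto)
    show "\<tau> (\<rho> x) = x" if "le (\<tau> c) x"
    proof (rule inj_onD[OF inj_inv])
      show "inv (\<tau> (\<rho> x)) = inv x"
      proof -
        have "H1 \<subseteq> inv x" using that cx \<tau> by (simp add: le_iff)
        then show ?thesis
          using inv_subset[OF cx(2)] \<tau>(3)[OF \<rho>_in[OF cx(2)]] inv0_\<rho>[OF cx(2)] by auto
      qed
    qed (use cx \<tau> \<rho>_in in auto)
  qed (use \<sigma> \<tau> \<rho>_in in auto)
  show ?thesis by (rule hamiltonian_quotients_lift) fact
qed

end

section \<open>Regions as cells of sign vectors\<close>

text \<open>Length and sign of the chosen vector are arbitrary; \<open>cell\<close>,
  \<open>sep\<close> and \<open>crossing\<close> are unaffected, since they use signs of products or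
  quotients of two inner products with it.\<close>

definition normal :: "'a::euclidean_space set \<Rightarrow> 'a" where
  "normal H = (SOME a. a \<noteq> 0 \<and> H = {x. a \<bullet> x = 0})"

definition cell :: "'a::euclidean_space set set \<Rightarrow> 'a \<Rightarrow> 'a set" where
  "cell \<H> x = {y. \<forall>H\<in>\<H>. 0 < (normal H \<bullet> x) * (normal H \<bullet> y)}"

definition sep :: "'a::euclidean_space set set \<Rightarrow> 'a \<Rightarrow> 'a \<Rightarrow> 'a set set" where
  "sep \<H> x y = {H\<in>\<H>. (normal H \<bullet> x) * (normal H \<bullet> y) < 0}"

lemma normal:
  assumes "arrangement \<H>" "H \<in> \<H>"
  shows "normal H \<noteq> 0" "x \<in> H \<longleftrightarrow> normal H \<bullet> x = 0"
proof -
  have "\<exists>a. a \<noteq> 0 \<and> H = {x. a \<bullet> x = 0}"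
    using assms by (auto simp: arrangement_def linear_hyperplane_def)
  from someI_ex[OF this] show "normal H \<noteq> 0" "x \<in> H \<longleftrightarrow> normal H \<bullet> x = 0"
    by (auto simp: normal_def)
qed

lemma arrangement_finite: "arrangement \<H> \<Longrightarrow> finite \<H>"
  by (simp add: arrangement_def)

lemma arrangement_subset: "arrangement \<H> \<Longrightarrow> \<H>0 \<subseteq> \<H> \<Longrightarrow> arrangement \<H>0"
  by (auto simp: arrangement_def intro: finite_subset)

text \<open>The component z of c orthogonal to the span of a and b is killed by both, hence by c; so
  z is orthogonal to itself.\<close>

lemma span_pair_of_kernel:
  fixes a b c :: "'a::euclidean_space"
  assumes "\<And>x. a \<bullet> x = 0 \<Longrightarrow> b \<bullet> x = 0 \<Longrightarrow> c \<bullet> x = 0"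
  obtains \<alpha> \<beta> where "c = \<alpha> *\<^sub>R a + \<beta> *\<^sub>R b"
proof -
  obtain y z where yz: "y \<in> span {a, b}" "\<And>w. w \<in> span {a, b} \<Longrightarrow> orthogonal z w" "c = y + z"
    using orthogonal_subspace_decomp_exists[of "{a, b}" c] by metis
  have "a \<bullet> z = 0" "b \<bullet> z = 0"
    using yz(2)[of a] yz(2)[of b] by (auto simp: orthogonal_def span_base inner_commute)
  then have "c \<bullet> z = 0" by (rule assms)
  moreover have "y \<bullet> z = 0" using yz(2)[OF yz(1)] by (simp add: orthogonal_def inner_commute)
  ultimately have "z = 0" using yz(3) by (simp add: inner_add_left)
  then obtain \<alpha> \<beta> where "c - \<alpha> *\<^sub>R a = \<beta> *\<^sub>R b"
    using yz by (auto simp: span_insert span_singleton)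
  then show ?thesis using that[of \<alpha> \<beta>] by (simp add: algebra_simps)
qed

lemma hyperplane_eq_imp_parallel:
  fixes a b :: "'a::euclidean_space"
  assumes "{x. a \<bullet> x = 0} = {x. b \<bullet> x = 0}"
  obtains \<alpha> where "b = \<alpha> *\<^sub>R a"
proof -
  obtain \<alpha> \<beta> where "b = \<alpha> *\<^sub>R a + \<beta> *\<^sub>R a"
    by (rule span_pair_of_kernel[of a a b]) (use assms in blast)
  then show ?thesis using that[of "\<alpha> + \<beta>"] by (simp add: scaleR_add_left)
qed

lemma normals_parallel_imp_eq:
  assumes "arrangement \<H>" "H \<in> \<H>" "K \<in> \<H>" "normal H = \<alpha> *\<^sub>R normal K"
  shows "H = K"
proof -
  have "\<alpha> \<noteq> 0" using normal(1)[OF assms(1,2)] assms(4) by auto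
  then show ?thesis using normal(2)[OF assms(1,2)] normal(2)[OF assms(1,3)] assms(4) by auto
qed

lemma not_in_Union_iff:
  "arrangement \<H> \<Longrightarrow> x \<notin> \<Union>\<H> \<longleftrightarrow> (\<forall>H\<in>\<H>. normal H \<bullet> x \<noteq> 0)"
  using normal(2) by blast

lemma mem_cell_self: "arrangement \<H> \<Longrightarrow> x \<notin> \<Union>\<H> \<Longrightarrow> x \<in> cell \<H> x"
  unfolding cell_def not_in_Union_iff by (auto simp: zero_less_mult_iff)

lemma cell_subset: "arrangement \<H> \<Longrightarrow> cell \<H> x \<subseteq> - \<Union>\<H>"
  using normal(2) unfolding cell_def by fastforce

lemma open_cell:
  assumes "arrangement \<H>"
  shows "open (cell \<H> x)"
proof -
  have "cell \<H> x = (\<Inter>H\<in>\<H>. {y. 0 < (normal H \<bullet> x) * (normal H \<bullet> y)})" by (auto simp: cell_def)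
  moreover have "open {y. 0 < (normal H \<bullet> x) * (normal H \<bullet> y)}" for H
    by (intro open_Collect_less continuous_intros)
  ultimately show ?thesis using arrangement_finite[OF assms] by auto
qed

lemma convex_cell: "convex (cell \<H> x)"
proof -
  have "cell \<H> x = (\<Inter>H\<in>\<H>. {y. ((normal H \<bullet> x) *\<^sub>R normal H) \<bullet> y > 0})"
    by (auto simp: cell_def)
  then show ?thesis by (simp only: convex_INT convex_halfspace_gt)
qed

text \<open>A cell is convex, hence connected; conversely a connected set containing points on both
  sides of a hyperplane meets it.\<close>

lemma connected_component_cell:
  assumes arr: "arrangement \<H>" and x: "x \<notin> \<Union>\<H>"
  shows "connected_component_set (- \<Union>\<H>) x = cell \<H> x"
proof
  show "cell \<H> x \<subseteq> connected_component_set (- \<Union>\<H>) x"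
    by (intro connected_component_maximal mem_cell_self convex_connected convex_cell cell_subset assms)
  show "connected_component_set (- \<Union>\<H>) x \<subseteq> cell \<H> x"
  proof
    fix y assume "y \<in> connected_component_set (- \<Union>\<H>) x"
    then obtain S where S: "connected S" "S \<subseteq> - \<Union>\<H>" "x \<in> S" "y \<in> S"
      by (auto simp: connected_component_def)
    have "0 < (normal H \<bullet> x) * (normal H \<bullet> y)" if H: "H \<in> \<H>" for H
    proof (rule ccontr)
      assume "\<not> ?thesis"
      then have "normal H \<bullet> x \<le> 0 \<and> 0 \<le> normal H \<bullet> y \<or> normal H \<bullet> y \<le> 0 \<and> 0 \<le> normal H \<bullet> x"
        by (auto simp: zero_less_mult_iff)
      then obtain z where "z \<in> S" "normal H \<bullet> z = 0"
        using connected_ivt_hyperplane[OF S(1)] S(3,4) by metis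
      then show False using S(2) H normal(2)[OF arr H] by blast
    qed
    then show "y \<in> cell \<H> x" by (simp add: cell_def)
  qed
qed

lemma cell_in_regions: "arrangement \<H> \<Longrightarrow> x \<notin> \<Union>\<H> \<Longrightarrow> cell \<H> x \<in> regions \<H>"
  unfolding regions_def components_iff using connected_component_cell by fastforce

lemma region_eq_cell:
  assumes "arrangement \<H>" "R \<in> regions \<H>" "x \<in> R"
  shows "R = cell \<H> x" "x \<notin> \<Union>\<H>"
proof -
  obtain y where y: "y \<in> - \<Union>\<H>" "R = connected_component_set (- \<Union>\<H>) y"
    using assms by (auto simp: regions_def components_iff)
  then have "x \<in> - \<Union>\<H>" using assms(3) connected_component_subset by blast
  moreover have "R = connected_component_set (- \<Union>\<H>) x"
    using connected_component_eq[of x "- \<Union>\<H>" y] y assms(3) by auto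
  ultimately show "R = cell \<H> x" "x \<notin> \<Union>\<H>" using connected_component_cell[of \<H> x] assms by auto
qed

lemma regionE:
  assumes "arrangement \<H>" "R \<in> regions \<H>"
  obtains x where "x \<notin> \<Union>\<H>" "R = cell \<H> x"
proof -
  obtain x where "x \<in> R" using assms(2) in_components_nonempty by (auto simp: regions_def)
  then show ?thesis using that region_eq_cell assms by blast
qed

lemma sep_symdiff:
  assumes "arrangement \<H>" "x \<notin> \<Union>\<H>" "y \<notin> \<Union>\<H>" "z \<notin> \<Union>\<H>"
  shows "H \<in> sep \<H> x z \<longleftrightarrow> H \<in> \<H> \<and> (H \<in> sep \<H> y x \<longleftrightarrow> H \<notin> sep \<H> y z)"
proof (cases "H \<in> \<H>")
  case True
  then have "normal H \<bullet> x \<noteq> 0" "normal H \<bullet> y \<noteq> 0" "normal H \<bullet> z \<noteq> 0"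
    using assms(2-4) not_in_Union_iff[OF assms(1)] by blast+
  then show ?thesis by (auto simp: sep_def mult_less_0_iff)
qed (simp add: sep_def)

lemma sep_commute: "sep \<H> x y = sep \<H> y x"
  by (simp add: sep_def mult.commute)

lemma sep_subset: "sep \<H> x y \<subseteq> \<H>"
  by (auto simp: sep_def)

lemma sep_remove:
  assumes "arrangement \<H>" "x \<notin> \<Union>\<H>" "y \<notin> \<Union>\<H>" "z \<notin> \<Union>\<H>"
    and "sep \<H> x z = {H}" "H \<in> sep \<H> x y"
  shows "sep \<H> z y = sep \<H> x y - {H}"
proof (rule set_eqI)
  fix K
  show "K \<in> sep \<H> z y \<longleftrightarrow> K \<in> sep \<H> x y - {H}"
    using sep_symdiff[OF assms(1,4,2,3), of K] sep_subset[of \<H> x y] assms(5,6) by (cases "K = H") auto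
qed

lemma sep_insert:
  assumes "arrangement \<H>" "b \<notin> \<Union>\<H>" "x \<notin> \<Union>\<H>" "z \<notin> \<Union>\<H>"
    and "sep \<H> x z = {H}" "H \<notin> sep \<H> b x"
  shows "sep \<H> b z = insert H (sep \<H> b x)"
proof (rule set_eqI)
  fix K
  show "K \<in> sep \<H> b z \<longleftrightarrow> K \<in> insert H (sep \<H> b x)"
    using sep_symdiff[OF assms(1,2,3,4), of K] sep_subset[of \<H> b x] sep_subset[of \<H> x z] assms(5,6)
    unfolding sep_commute[of \<H> x b] by (cases "K = H") auto
qed

lemma finite_sep: "arrangement \<H> \<Longrightarrow> finite (sep \<H> x y)"
  using arrangement_finite sep_subset finite_subset by metis

lemma cell_eq_iff:
  assumes "arrangement \<H>" "x \<notin> \<Union>\<H>" "y \<notin> \<Union>\<H>"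
  shows "cell \<H> x = cell \<H> y \<longleftrightarrow> sep \<H> x y = {}"
proof
  assume "cell \<H> x = cell \<H> y"
  then have "y \<in> cell \<H> x" using mem_cell_self assms by blast
  then show "sep \<H> x y = {}" unfolding sep_def cell_def by fastforce
next
  assume "sep \<H> x y = {}"
  then have pos: "0 < (normal H \<bullet> x) * (normal H \<bullet> y)" if "H \<in> \<H>" for H
    using that assms not_in_Union_iff[OF assms(1)] unfolding sep_def
    by (metis (mono_tags, lifting) empty_iff linorder_cases mem_Collect_eq mult_eq_0_iff)
  have "0 < (normal H \<bullet> x) * (normal H \<bullet> z) \<longleftrightarrow> 0 < (normal H \<bullet> y) * (normal H \<bullet> z)"
    if "H \<in> \<H>" for H z
    using pos[OF that] by (auto simp: zero_less_mult_iff)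
  then show "cell \<H> x = cell \<H> y" by (auto simp: cell_def)
qed

lemma sep_hyps_cell:
  assumes arr: "arrangement \<H>" and x: "x \<notin> \<Union>\<H>" and y: "y \<notin> \<Union>\<H>"
  shows "sep_hyps \<H> (cell \<H> x) (cell \<H> y) = sep \<H> x y"
proof (intro equalityI subsetI)
  fix H assume "H \<in> sep_hyps \<H> (cell \<H> x) (cell \<H> y)"
  then obtain a where H: "H \<in> \<H>" and a: "H = {z. a \<bullet> z = 0}"
    and xy: "cell \<H> x \<subseteq> {z. a \<bullet> z < 0}" "cell \<H> y \<subseteq> {z. 0 < a \<bullet> z}"
    by (auto simp: sep_hyps_def)
  have "{z. a \<bullet> z = 0} = {z. normal H \<bullet> z = 0}" using a normal(2)[OF arr H] by blast
  then obtain \<alpha> where \<alpha>: "normal H = \<alpha> *\<^sub>R a" using hyperplane_eq_imp_parallel by blast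
  have "\<alpha> \<noteq> 0" using \<alpha> normal(1)[OF arr H] by auto
  moreover have "a \<bullet> x < 0" "0 < a \<bullet> y" using xy mem_cell_self arr x y by blast+
  ultimately have "(normal H \<bullet> x) * (normal H \<bullet> y) < 0"
    unfolding \<alpha> by (auto simp: mult_less_0_iff zero_less_mult_iff linorder_neq_iff)
  then show "H \<in> sep \<H> x y" using H by (simp add: sep_def)
next
  fix H assume H: "H \<in> sep \<H> x y"
  \<comment> \<open>The normal rescaled so that x is on its negative side, as
    \<open>sep_hyps\<close> demands of the first region.\<close>
  define a where "a = - (normal H \<bullet> x) *\<^sub>R normal H"
  have "H \<in> \<H>" "normal H \<bullet> x \<noteq> 0" "(normal H \<bullet> x) * (normal H \<bullet> y) < 0"
    using H by (auto simp: sep_def)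
  moreover have "H = {z. a \<bullet> z = 0}"
    using normal(2)[OF arr \<open>H \<in> \<H>\<close>] \<open>normal H \<bullet> x \<noteq> 0\<close> by (auto simp: a_def)
  moreover have "cell \<H> x \<subseteq> {z. a \<bullet> z < 0}"
    using \<open>H \<in> \<H>\<close> by (auto simp: cell_def a_def)
  moreover have "0 < a \<bullet> z" if "z \<in> cell \<H> y" for z
  proof -
    have "0 < (normal H \<bullet> y) * (normal H \<bullet> z)" using that \<open>H \<in> \<H>\<close> by (auto simp: cell_def)
    then show ?thesis using \<open>(normal H \<bullet> x) * (normal H \<bullet> y) < 0\<close>
      by (auto simp: a_def mult_less_0_iff zero_less_mult_iff)
  qed
  ultimately show "H \<in> sep_hyps \<H> (cell \<H> x) (cell \<H> y)"
    unfolding sep_hyps_def by blast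
qed

lemma reg_adj_cell:
  "arrangement \<H> \<Longrightarrow> x \<notin> \<Union>\<H> \<Longrightarrow> y \<notin> \<Union>\<H> \<Longrightarrow>
    reg_adj \<H> (cell \<H> x) (cell \<H> y) \<longleftrightarrow> card (sep \<H> x y) = 1"
  by (simp add: reg_adj_def cell_in_regions sep_hyps_cell)

lemma reg_proj_cell:
  assumes arr: "arrangement \<H>" and "\<H>0 \<subseteq> \<H>" and x: "x \<notin> \<Union>\<H>"
  shows "reg_proj \<H>0 (cell \<H> x) = cell \<H>0 x"
  unfolding reg_proj_def
proof (rule the_equality)
  have arr0: "arrangement \<H>0" using assms arrangement_subset by blast
  have x0: "x \<notin> \<Union>\<H>0" using assms by blast
  show "cell \<H>0 x \<in> regions \<H>0 \<and> cell \<H> x \<subseteq> cell \<H>0 x"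
    using cell_in_regions[OF arr0 x0] assms(2) by (auto simp: cell_def)
  fix R assume "R \<in> regions \<H>0 \<and> cell \<H> x \<subseteq> R"
  then show "R = cell \<H>0 x"
    using mem_cell_self[OF arr x] region_eq_cell[OF arr0] by blast
qed

lemma inj_on_sep_hyps:
  assumes arr: "arrangement \<H>" and b: "b \<notin> \<Union>\<H>"
  shows "inj_on (sep_hyps \<H> (cell \<H> b)) (regions \<H>)"
proof (rule inj_onI)
  fix R R' assume R: "R \<in> regions \<H>" "R' \<in> regions \<H>"
    and eq: "sep_hyps \<H> (cell \<H> b) R = sep_hyps \<H> (cell \<H> b) R'"
  obtain x y where xy: "x \<notin> \<Union>\<H>" "R = cell \<H> x" "y \<notin> \<Union>\<H>" "R' = cell \<H> y"
    using R regionE[OF arr] by metis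
  then have "sep \<H> b x = sep \<H> b y" using eq sep_hyps_cell[OF arr b] by simp
  then have "sep \<H> x y = {}" using sep_symdiff[OF arr xy(1) b xy(3)] by blast
  then show "R = R'" using xy cell_eq_iff[OF arr xy(1,3)] by simp
qed

lemma finite_regions:
  assumes "arrangement \<H>"
  shows "finite (regions \<H>)"
proof (cases "regions \<H> = {}")
  case False
  then obtain b where "b \<notin> \<Union>\<H>" using regionE assms by blast
  then have "inj_on (sep_hyps \<H> (cell \<H> b)) (regions \<H>)" by (rule inj_on_sep_hyps[OF assms])
  moreover have "sep_hyps \<H> (cell \<H> b) ` regions \<H> \<subseteq> Pow \<H>" by (auto simp: sep_hyps_def)
  ultimately show ?thesis
    using arrangement_finite[OF assms] by (metis finite_Pow_iff finite_imageD finite_subset)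
qed simp

section \<open>Walking along lines\<close>

text \<open>The line \<open>x + t v\<close> meets \<open>H\<close> at time \<open>crossing H x v\<close>, unless \<open>normal H \<bullet> v = 0\<close>.\<close>

definition crossing :: "'a::euclidean_space set \<Rightarrow> 'a \<Rightarrow> 'a \<Rightarrow> real" where
  "crossing H x v = - (normal H \<bullet> x) / (normal H \<bullet> v)"

lemma normal_on_line:
  "normal H \<bullet> v \<noteq> 0 \<Longrightarrow> normal H \<bullet> (x + t *\<^sub>R v) = (normal H \<bullet> v) * (t - crossing H x v)"
  by (simp add: crossing_def inner_add_right field_simps)

lemma not_in_Union_line:
  assumes "arrangement \<H>" "x \<notin> \<Union>\<H>" "\<And>H. H \<in> \<H> \<Longrightarrow> normal H \<bullet> v \<noteq> 0 \<Longrightarrow> crossing H x v \<noteq> t"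
  shows "x + t *\<^sub>R v \<notin> \<Union>\<H>"
  unfolding not_in_Union_iff[OF assms(1)]
proof
  fix H assume H: "H \<in> \<H>"
  show "normal H \<bullet> (x + t *\<^sub>R v) \<noteq> 0"
  proof (cases "normal H \<bullet> v = 0")
    case True
    then show ?thesis using H assms(2) not_in_Union_iff[OF assms(1)] by (auto simp: inner_add_right)
  next
    case False
    then show ?thesis using H assms(3)[of H] by (simp add: normal_on_line)
  qed
qed

lemma sep_line:
  assumes "arrangement \<H>" "x \<notin> \<Union>\<H>" "0 < t"
    and "\<And>H. H \<in> \<H> \<Longrightarrow> normal H \<bullet> v \<noteq> 0 \<Longrightarrow> crossing H x v \<noteq> t"
  shows "sep \<H> x (x + t *\<^sub>R v) = {H\<in>\<H>. normal H \<bullet> v \<noteq> 0 \<and> 0 < crossing H x v \<and> crossing H x v < t}"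
proof -
  have "(normal H \<bullet> x) * (normal H \<bullet> (x + t *\<^sub>R v)) < 0 \<longleftrightarrow>
      normal H \<bullet> v \<noteq> 0 \<and> 0 < crossing H x v \<and> crossing H x v < t" if H: "H \<in> \<H>" for H
  proof (cases "normal H \<bullet> v = 0")
    case True
    then show ?thesis by (auto simp: inner_add_right mult_less_0_iff)
  next
    case False
    have "normal H \<bullet> x = (normal H \<bullet> v) * (0 - crossing H x v)"
      using normal_on_line[OF False, of x 0] by simp
    moreover have "normal H \<bullet> x \<noteq> 0" using H assms(2) not_in_Union_iff[OF assms(1)] by blast
    ultimately show ?thesis
      unfolding normal_on_line[OF False] using False \<open>0 < t\<close>
      by (auto simp: mult_less_0_iff zero_less_mult_iff linorder_neq_iff)
  qed
  then show ?thesis by (auto simp: sep_def)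
qed

lemma first_crossing:
  assumes arr: "arrangement \<H>" and x: "x \<notin> \<Union>\<H>"
    and P: "P = {H\<in>\<H>. normal H \<bullet> v \<noteq> 0 \<and> 0 < crossing H x v}" "P \<noteq> {}"
    and inj: "inj_on (\<lambda>H. crossing H x v) P"
  obtains H t where "H \<in> P" "0 < t" "x + t *\<^sub>R v \<notin> \<Union>\<H>" "sep \<H> x (x + t *\<^sub>R v) = {H}"
    "\<And>K. K \<in> P \<Longrightarrow> crossing H x v \<le> crossing K x v"
proof -
  have "finite P" using P(1) arrangement_finite[OF arr] by simp
  then have "Min ((\<lambda>H. crossing H x v) ` P) \<in> (\<lambda>H. crossing H x v) ` P" using P(2) by simp
  then obtain H where H: "H \<in> P" "crossing H x v = Min ((\<lambda>H. crossing H x v) ` P)" by auto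
  then have le: "crossing H x v \<le> crossing K x v" if "K \<in> P" for K
    using that \<open>finite P\<close> by simp
  \<comment> \<open>A lower bound for the gap between the first crossing time and all other values
    of \<open>crossing\<close>, including the value 0 that division by zero gives to hyperplanes
    parallel to v. Going d / 2 further passes \<open>H\<close> only.\<close>
  obtain d where d: "0 < d"
    "\<And>c. c \<in> (\<lambda>H. crossing H x v) ` \<H> \<Longrightarrow> c \<noteq> crossing H x v \<Longrightarrow> d \<le> dist (crossing H x v) c"
    using finite_set_avoid[of "(\<lambda>H. crossing H x v) ` \<H>" "crossing H x v"] arrangement_finite[OF arr]
    by auto
  define t where "t = crossing H x v + d / 2"
  have t: "0 < t" using H(1) P(1) d(1) by (auto simp: t_def)
  have ne: "crossing K x v \<noteq> t" if "K \<in> \<H>" for K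
    using d(1) d(2)[of "crossing K x v"] that by (auto simp: t_def dist_real_def)
  have "K = H" if K: "K \<in> \<H>" "normal K \<bullet> v \<noteq> 0" "0 < crossing K x v" "crossing K x v < t" for K
  proof -
    have "K \<in> P" using K P by simp
    then have "crossing K x v = crossing H x v"
      using d(1) d(2)[of "crossing K x v"] K(1,4) le[of K] by (force simp: t_def dist_real_def)
    then show ?thesis using inj H(1) \<open>K \<in> P\<close> by (auto dest: inj_onD)
  qed
  then have "sep \<H> x (x + t *\<^sub>R v) = {H}"
    using sep_line[OF arr x t ne] H(1) P(1) d(1) by (auto simp: t_def)
  then show ?thesis using that H(1) t not_in_Union_line[OF arr x ne] le by blast
qed

lemma crossing_pair:
  assumes arr: "arrangement \<H>" and x: "x \<notin> \<Union>\<H>" and H: "H \<in> \<H>" "normal H \<bullet> v \<noteq> 0"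
    and ne: "\<And>K. K \<in> \<H> \<Longrightarrow> K \<noteq> H \<Longrightarrow> normal K \<bullet> v \<noteq> 0 \<Longrightarrow> crossing K x v \<noteq> crossing H x v"
  obtains s t where "s < crossing H x v" "crossing H x v < t" "x + s *\<^sub>R v \<notin> \<Union>\<H>" "x + t *\<^sub>R v \<notin> \<Union>\<H>"
    "sep \<H> (x + s *\<^sub>R v) (x + t *\<^sub>R v) = {H}"
proof -
  define c where "c = crossing H x v"
  obtain d where d: "0 < d"
    "\<And>k. k \<in> (\<lambda>H. crossing H x v) ` \<H> \<Longrightarrow> k \<noteq> c \<Longrightarrow> d \<le> dist c k"
    using finite_set_avoid[of "(\<lambda>H. crossing H x v) ` \<H>" c] arrangement_finite[OF arr] by auto
  define y where "y = x + (c - d / 2) *\<^sub>R v"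
  have far: "crossing K x v = c \<or> crossing K x v \<le> c - d \<or> c + d \<le> crossing K x v" if "K \<in> \<H>" for K
    using d(2)[of "crossing K x v"] that by (auto simp: dist_real_def abs_if split: if_splits)
  have y: "y \<notin> \<Union>\<H>" unfolding y_def
    by (rule not_in_Union_line[OF arr x]) (use far d(1) in force)
  \<comment> \<open>\<open>sep_line\<close> counts times from its starting point, so the line is
    restarted at y, which shifts all crossing times.\<close>
  have y': "x + (c + d / 2) *\<^sub>R v \<notin> \<Union>\<H>"
    by (rule not_in_Union_line[OF arr x]) (use far d(1) in force)
  have shift: "crossing K y v = crossing K x v - (c - d / 2)" if "normal K \<bullet> v \<noteq> 0" for K
    using that by (simp add: y_def crossing_def inner_add_right field_simps)
  have "sep \<H> y (y + d *\<^sub>R v) = {K\<in>\<H>. normal K \<bullet> v \<noteq> 0 \<and> 0 < crossing K y v \<and> crossing K y v < d}"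
  proof (rule sep_line[OF arr y d(1)])
    fix K assume "K \<in> \<H>" "normal K \<bullet> v \<noteq> 0"
    then show "crossing K y v \<noteq> d" using far[of K] shift[of K] d(1) by auto
  qed
  also have "\<dots> = {H}"
  proof (intro equalityI subsetI)
    fix K assume "K \<in> {K\<in>\<H>. normal K \<bullet> v \<noteq> 0 \<and> 0 < crossing K y v \<and> crossing K y v < d}"
    then show "K \<in> {H}" using far[of K] shift[of K] d(1) ne[of K] by (auto simp: c_def)
  qed (use H shift[of H] d(1) in \<open>auto simp: c_def\<close>)
  also have "y + d *\<^sub>R v = x + (c + d / 2) *\<^sub>R v"
    by (simp add: y_def algebra_simps flip: scaleR_add_left)
  finally show ?thesis
    using that[of "c - d / 2" "c + d / 2"] y y' d(1) by (simp add: y_def c_def)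
qed

lemma open_avoids_hyperplanes:
  fixes U :: "'a::euclidean_space set"
  assumes "open U" "U \<noteq> {}" "finite W" "0 \<notin> W"
  obtains x where "x \<in> U" "\<And>w. w \<in> W \<Longrightarrow> w \<bullet> x \<noteq> 0"
proof -
  have "negligible (\<Union>w\<in>W. {x. w \<bullet> x = 0})"
    using assms by (intro negligible_Union) (auto intro!: negligible_hyperplane)
  then have "\<not> U \<subseteq> (\<Union>w\<in>W. {x. w \<bullet> x = 0})"
    using assms open_not_negligible negligible_subset by blast
  then show ?thesis using that by blast
qed

text \<open>For generic \<open>x'\<close> in the cell of \<open>x\<close>, the segment from \<open>x'\<close> to \<open>y\<close> crosses the hyperplanes
  one at a time.\<close>

lemma neighbour_towards:
  assumes arr: "arrangement \<H>" and x: "x \<notin> \<Union>\<H>" and y: "y \<notin> \<Union>\<H>" and ne: "sep \<H> x y \<noteq> {}"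
  obtains z H where "z \<notin> \<Union>\<H>" "H \<in> sep \<H> x y" "sep \<H> x z = {H}"
proof -
  \<comment> \<open>With v = y - x', H and K are crossed at equal times only if x' is orthogonal to
    this vector, which is nonzero because distinct hyperplanes have non-parallel normals.\<close>
  define W where "W = {w. \<exists>H\<in>\<H>. \<exists>K\<in>\<H>. H \<noteq> K \<and>
    w = (normal K \<bullet> y) *\<^sub>R normal H - (normal H \<bullet> y) *\<^sub>R normal K}"
  have "W \<subseteq> (\<lambda>(H, K). (normal K \<bullet> y) *\<^sub>R normal H - (normal H \<bullet> y) *\<^sub>R normal K) ` (\<H> \<times> \<H>)"
  proof
    fix w assume "w \<in> W"
    then obtain H K where "H \<in> \<H>" "K \<in> \<H>"
      "w = (normal K \<bullet> y) *\<^sub>R normal H - (normal H \<bullet> y) *\<^sub>R normal K"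
      unfolding W_def by blast
    then show "w \<in> (\<lambda>(H, K). (normal K \<bullet> y) *\<^sub>R normal H - (normal H \<bullet> y) *\<^sub>R normal K) ` (\<H> \<times> \<H>)"
      by (intro image_eqI[of _ _ "(H, K)"]) simp_all
  qed
  then have "finite W"
    by (rule finite_subset) (simp add: arrangement_finite[OF arr])
  moreover have "0 \<notin> W"
  proof
    assume "0 \<in> W"
    then obtain H K where HK: "H \<in> \<H>" "K \<in> \<H>" "H \<noteq> K"
      "0 = (normal K \<bullet> y) *\<^sub>R normal H - (normal H \<bullet> y) *\<^sub>R normal K"
      unfolding W_def by blast
    have "normal K \<bullet> y \<noteq> 0" using HK y not_in_Union_iff[OF arr] by blast
    then have "normal H = (1 / (normal K \<bullet> y)) *\<^sub>R ((normal K \<bullet> y) *\<^sub>R normal H)" by simp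
    also have "\<dots> = ((normal H \<bullet> y) / (normal K \<bullet> y)) *\<^sub>R normal K" using HK(4) by simp
    finally have "normal H = ((normal H \<bullet> y) / (normal K \<bullet> y)) *\<^sub>R normal K" .
    then show False using normals_parallel_imp_eq arr HK by blast
  qed
  moreover have "cell \<H> x \<noteq> {}" using mem_cell_self arr x by blast
  ultimately obtain x' where x': "x' \<in> cell \<H> x" and gen: "\<And>w. w \<in> W \<Longrightarrow> w \<bullet> x' \<noteq> 0"
    using open_avoids_hyperplanes open_cell[OF arr] by metis
  have x'2: "x' \<notin> \<Union>\<H>" using x' cell_subset arr by blast
  have xx': "sep \<H> x x' = {}" using x' x'2 region_eq_cell[OF arr cell_in_regions[OF arr x] x'] cell_eq_iff arr x
    by blast
  have same: "sep \<H> x' z = sep \<H> x z" if "z \<notin> \<Union>\<H>" for z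
  proof (rule set_eqI)
    fix K
    show "K \<in> sep \<H> x' z \<longleftrightarrow> K \<in> sep \<H> x z"
      using sep_symdiff[OF arr x'2 x that, of K] sep_subset[of \<H> x z] xx' by auto
  qed
  define v where "v = y - x'"
  define P where "P = {H\<in>\<H>. normal H \<bullet> v \<noteq> 0 \<and> 0 < crossing H x' v}"
  have "crossing H x' v \<noteq> 1" if "H \<in> \<H>" "normal H \<bullet> v \<noteq> 0" for H
    using normal_on_line[OF that(2), of x' 1] that y not_in_Union_iff[OF arr, of y] by (auto simp: v_def)
  then have "sep \<H> x' (x' + 1 *\<^sub>R v) = {H\<in>\<H>. normal H \<bullet> v \<noteq> 0 \<and> 0 < crossing H x' v \<and> crossing H x' v < 1}"
    by (intro sep_line[OF arr x'2]) auto
  then have sep_y: "sep \<H> x y = {H\<in>P. crossing H x' v < 1}"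
    using same[OF y] by (auto simp: v_def P_def)
  then have "P \<noteq> {}" using ne by blast
  moreover have "inj_on (\<lambda>H. crossing H x' v) P"
  proof (rule inj_onI, rule ccontr)
    fix H K assume HK: "H \<in> P" "K \<in> P" "crossing H x' v = crossing K x' v" "H \<noteq> K"
    then have "(normal H \<bullet> x') * (normal K \<bullet> v) = (normal K \<bullet> x') * (normal H \<bullet> v)"
      by (simp add: P_def crossing_def field_simps)
    then have "((normal K \<bullet> y) *\<^sub>R normal H - (normal H \<bullet> y) *\<^sub>R normal K) \<bullet> x' = 0"
      by (simp add: v_def inner_diff_left inner_diff_right algebra_simps)
    moreover have "(normal K \<bullet> y) *\<^sub>R normal H - (normal H \<bullet> y) *\<^sub>R normal K \<in> W"
      using HK by (unfold W_def P_def, blast)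
    ultimately show False using gen by blast
  qed
  ultimately obtain H t where Ht: "H \<in> P" "0 < t" "x' + t *\<^sub>R v \<notin> \<Union>\<H>" "sep \<H> x' (x' + t *\<^sub>R v) = {H}"
    "\<And>K. K \<in> P \<Longrightarrow> crossing H x' v \<le> crossing K x' v"
    using first_crossing[OF arr x'2 P_def] by metis
  have "H \<in> sep \<H> x y" using Ht(1,5) ne sep_y by fastforce
  then show ?thesis using that Ht(3,4) same by metis
qed

section \<open>The poset of regions, ordered by inclusion of separating sets\<close>

lemma reg_walk_exists:
  assumes arr: "arrangement \<H>" and "x \<notin> \<Union>\<H>" "y \<notin> \<Union>\<H>"
  shows "\<exists>xs. reg_walk \<H> xs \<and> hd xs = cell \<H> x \<and> last xs = cell \<H> y \<and> length xs = Suc (card (sep \<H> x y))"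
  using assms(2)
proof (induction "card (sep \<H> x y)" arbitrary: x)
  case 0
  then have "sep \<H> x y = {}" using finite_sep[OF arr] by simp
  then have "cell \<H> x = cell \<H> y" using cell_eq_iff[OF arr 0(2) assms(3)] by simp
  then show ?case using 0(1) cell_in_regions[OF arr 0(2)]
    by (intro exI[of _ "[cell \<H> x]"]) (simp add: reg_walk_def)
next
  case (Suc n)
  then have "sep \<H> x y \<noteq> {}" by auto
  then obtain z H where z: "z \<notin> \<Union>\<H>" "H \<in> sep \<H> x y" "sep \<H> x z = {H}"
    using neighbour_towards[OF arr Suc.prems assms(3)] by blast
  have "sep \<H> z y = sep \<H> x y - {H}"
    using sep_remove[OF arr Suc.prems assms(3) z(1,3,2)] .
  then have n: "n = card (sep \<H> z y)" using Suc.hyps(2) z(2) finite_sep[OF arr] by simp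
  then obtain xs where xs: "reg_walk \<H> xs" "hd xs = cell \<H> z" "last xs = cell \<H> y" "length xs = Suc n"
    using Suc.hyps(1) z(1) by metis
  have adj: "reg_adj \<H> (cell \<H> x) (cell \<H> z)" using reg_adj_cell[OF arr Suc.prems z(1)] z(3) by simp
  have "reg_walk \<H> (cell \<H> x # xs)"
    unfolding reg_walk_def
  proof (intro conjI allI impI)
    fix i assume "Suc i < length (cell \<H> x # xs)"
    then show "reg_adj \<H> ((cell \<H> x # xs) ! i) ((cell \<H> x # xs) ! Suc i)"
      using xs adj by (cases i) (auto simp: reg_walk_def hd_conv_nth)
  qed (use xs(1) cell_in_regions[OF arr Suc.prems] in \<open>auto simp: reg_walk_def\<close>)
  then show ?case using xs Suc.hyps(2) by (intro exI[of _ "cell \<H> x # xs"]) auto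
qed

text \<open>Each step of a walk crosses one hyperplane and \<open>sep\<close> obeys the triangle
  inequality. The bound is strict because n steps list n + 1 regions.\<close>

lemma reg_walk_length:
  assumes arr: "arrangement \<H>" and "y \<notin> \<Union>\<H>"
  shows "reg_walk \<H> xs \<Longrightarrow> hd xs = cell \<H> x \<Longrightarrow> x \<notin> \<Union>\<H> \<Longrightarrow> last xs = cell \<H> y \<Longrightarrow>
    card (sep \<H> x y) < length xs"
proof (induction xs arbitrary: x)
  case (Cons R xs)
  show ?case
  proof (cases "xs = []")
    case True
    then show ?thesis using Cons.prems assms cell_eq_iff[OF arr, of x y] by simp
  next
    case False
    have "reg_adj \<H> R (hd xs)" "reg_walk \<H> xs"
      using Cons.prems(1) False unfolding reg_walk_def by (force simp: hd_conv_nth)+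
    then obtain z where z: "z \<notin> \<Union>\<H>" "hd xs = cell \<H> z"
      using regionE[OF arr] by (auto simp: reg_adj_def)
    have "card (sep \<H> z y) < length xs"
      using Cons.IH[OF \<open>reg_walk \<H> xs\<close> z(2,1)] Cons.prems False by simp
    moreover have "card (sep \<H> x z) = 1"
      using \<open>reg_adj \<H> R (hd xs)\<close> reg_adj_cell[OF arr] Cons.prems z by simp
    moreover have "card (sep \<H> x y) \<le> card (sep \<H> x z \<union> sep \<H> z y)"
    proof (intro card_mono subsetI)
      fix K assume "K \<in> sep \<H> x y"
      then show "K \<in> sep \<H> x z \<union> sep \<H> z y"
        using sep_symdiff[OF arr Cons.prems(3) z(1) assms(2), of K] by (auto simp: sep_commute[of \<H> x z])
    qed (simp add: finite_sep[OF arr])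
    ultimately show ?thesis using card_Un_le[of "sep \<H> x z" "sep \<H> z y"] by simp
  qed
qed (simp add: reg_walk_def)

lemma reg_dist_cell:
  assumes "arrangement \<H>" "x \<notin> \<Union>\<H>" "y \<notin> \<Union>\<H>"
  shows "reg_dist \<H> (cell \<H> x) (cell \<H> y) = card (sep \<H> x y)"
  unfolding reg_dist_def
proof (rule Least_equality)
  show "\<exists>xs. reg_walk \<H> xs \<and> hd xs = cell \<H> x \<and> last xs = cell \<H> y \<and> length xs = Suc (card (sep \<H> x y))"
    using reg_walk_exists assms .
  show "card (sep \<H> x y) \<le> n"
    if "\<exists>xs. reg_walk \<H> xs \<and> hd xs = cell \<H> x \<and> last xs = cell \<H> y \<and> length xs = Suc n" for n
    using that reg_walk_length[OF assms(1,3) _ _ assms(2)] by fastforce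
qed

lemma pr_cover_cell:
  assumes arr: "arrangement \<H>" and b: "b \<notin> \<Union>\<H>" and x: "x \<notin> \<Union>\<H>" and y: "y \<notin> \<Union>\<H>"
  shows "pr_cover \<H> (cell \<H> b) (cell \<H> x) (cell \<H> y) \<longleftrightarrow>
    (\<exists>H. H \<notin> sep \<H> b x \<and> sep \<H> b y = insert H (sep \<H> b x))"
proof -
  have "card (sep \<H> x y) = 1 \<and> card (sep \<H> b y) = Suc (card (sep \<H> b x)) \<longleftrightarrow>
    (\<exists>H. H \<notin> sep \<H> b x \<and> sep \<H> b y = insert H (sep \<H> b x))" (is "?L \<longleftrightarrow> ?R")
  proof
    assume L: ?L
    then obtain H where H: "sep \<H> x y = {H}" by (auto simp: card_Suc_eq)
    have "H \<notin> sep \<H> b x"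
    proof
      assume "H \<in> sep \<H> b x"
      then have "sep \<H> y b = sep \<H> x b - {H}"
        by (intro sep_remove[OF arr x b y H]) (simp add: sep_commute)
      then have "card (sep \<H> b y) \<le> card (sep \<H> b x)"
        using finite_sep[OF arr] by (auto simp: sep_commute intro: card_mono)
      then show False using L by simp
    qed
    then show ?R using sep_insert[OF arr b x y H] by blast
  next
    assume ?R
    then obtain H where H: "H \<notin> sep \<H> b x" "sep \<H> b y = insert H (sep \<H> b x)" by blast
    have "sep \<H> x y = {H}"
    proof (rule set_eqI)
      fix K
      show "K \<in> sep \<H> x y \<longleftrightarrow> K \<in> {H}"
        using sep_symdiff[OF arr x b y, of K] H sep_subset[of \<H> b y] by (cases "K = H") auto
    qed
    then show ?L using H finite_sep[OF arr] by simp
  qed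
  then show ?thesis using assms by (simp add: pr_cover_def reg_adj_cell reg_dist_cell)
qed

lemma pr_le_imp_subset:
  assumes arr: "arrangement \<H>" and b: "b \<notin> \<Union>\<H>"
    and "pr_le \<H> (cell \<H> b) R R'" "R \<in> regions \<H>"
  shows "R' \<in> regions \<H> \<and> sep_hyps \<H> (cell \<H> b) R \<subseteq> sep_hyps \<H> (cell \<H> b) R'"
  using assms(3) unfolding pr_le_def
proof (induction rule: rtranclp_induct)
  case base
  then show ?case using assms by simp
next
  case (step S T)
  then have "S \<in> regions \<H>" "T \<in> regions \<H>" by (auto simp: pr_cover_def reg_adj_def)
  then obtain x y where xy: "x \<notin> \<Union>\<H>" "S = cell \<H> x" "y \<notin> \<Union>\<H>" "T = cell \<H> y"
    using regionE[OF arr] by metis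
  then have "sep_hyps \<H> (cell \<H> b) S \<subseteq> sep_hyps \<H> (cell \<H> b) T"
    using step.hyps(2) pr_cover_cell[OF arr b, of x y] sep_hyps_cell[OF arr b] by auto
  then show ?case using step.IH \<open>T \<in> regions \<H>\<close> by blast
qed

text \<open>Step from x to a neighbour towards y. The hyperplane crossed separates x from y, so by
  the inclusion it separates b from y but not from x; the step is therefore a cover upwards.\<close>

lemma subset_imp_pr_le:
  assumes arr: "arrangement \<H>" and b: "b \<notin> \<Union>\<H>" and y: "y \<notin> \<Union>\<H>"
  shows "x \<notin> \<Union>\<H> \<Longrightarrow> sep \<H> b x \<subseteq> sep \<H> b y \<Longrightarrow> pr_le \<H> (cell \<H> b) (cell \<H> x) (cell \<H> y)"
proof (induction "card (sep \<H> x y)" arbitrary: x)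
  case 0
  then have "sep \<H> x y = {}" using finite_sep[OF arr] by simp
  then have "cell \<H> x = cell \<H> y" using cell_eq_iff[OF arr 0(2) y] by simp
  then show ?case by (simp add: pr_le_def)
next
  case (Suc n)
  then have "sep \<H> x y \<noteq> {}" by auto
  then obtain z H where z: "z \<notin> \<Union>\<H>" "H \<in> sep \<H> x y" "sep \<H> x z = {H}"
    using neighbour_towards[OF arr Suc.prems(1) y] by blast
  have "sep \<H> z y = sep \<H> x y - {H}"
    using sep_remove[OF arr Suc.prems(1) y z(1,3,2)] .
  then have n: "n = card (sep \<H> z y)" using Suc.hyps(2) z(2) finite_sep[OF arr] by simp
  have H: "H \<in> sep \<H> b y" "H \<notin> sep \<H> b x"
    using z(2) sep_symdiff[OF arr Suc.prems(1) b y, of H] Suc.prems(2) by auto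
  have bz: "sep \<H> b z = insert H (sep \<H> b x)"
    using sep_insert[OF arr b Suc.prems(1) z(1,3) H(2)] .
  then have "pr_cover \<H> (cell \<H> b) (cell \<H> x) (cell \<H> z)"
    using pr_cover_cell[OF arr b Suc.prems(1) z(1)] H by blast
  moreover have "pr_le \<H> (cell \<H> b) (cell \<H> z) (cell \<H> y)"
    by (rule Suc.hyps(1)[OF n z(1)]) (simp add: bz H(1) Suc.prems(2))
  ultimately show ?case by (simp add: pr_le_def)
qed

lemma pr_le_cell_iff:
  assumes "arrangement \<H>" "b \<notin> \<Union>\<H>" "x \<notin> \<Union>\<H>" "y \<notin> \<Union>\<H>"
  shows "pr_le \<H> (cell \<H> b) (cell \<H> x) (cell \<H> y) \<longleftrightarrow> sep \<H> b x \<subseteq> sep \<H> b y"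
  using subset_imp_pr_le[OF assms(1,2,4,3)] assms
    pr_le_imp_subset[OF assms(1,2) _ cell_in_regions[OF assms(1,3)], of "cell \<H> y"]
  unfolding sep_hyps_cell[OF assms(1,2,3)] sep_hyps_cell[OF assms(1,2,4)] by blast

section \<open>Adding hyperplanes transverse to a common direction\<close>

text \<open>The normal of L is a combination of those of H and K. As L is parallel to v, the two
  coefficients, scaled by the inner products with v, are opposite: the side of L tells which of H
  and K is crossed first.\<close>

lemma pencil_coordinates:
  assumes arr: "arrangement \<H>" and HKL: "H \<in> \<H>" "K \<in> \<H>" "L \<in> \<H>" "H \<inter> K \<subseteq> L"
    and v: "normal L \<bullet> v = 0" "normal H \<bullet> v \<noteq> 0" "normal K \<bullet> v \<noteq> 0"
  obtains \<gamma> where "\<gamma> \<noteq> 0" "\<And>x. normal L \<bullet> x = \<gamma> * (crossing K x v - crossing H x v)"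
proof -
  have "normal L \<bullet> x = 0" if "normal H \<bullet> x = 0" "normal K \<bullet> x = 0" for x
    using that HKL(4) normal(2)[OF arr HKL(1)] normal(2)[OF arr HKL(2)] normal(2)[OF arr HKL(3)] by blast
  then obtain \<alpha> \<beta> where L: "normal L = \<alpha> *\<^sub>R normal H + \<beta> *\<^sub>R normal K"
    using span_pair_of_kernel by blast
  define \<gamma> where "\<gamma> = \<alpha> * (normal H \<bullet> v)"
  have \<gamma>: "\<beta> * (normal K \<bullet> v) = - \<gamma>"
    using v(1) by (simp add: L \<gamma>_def inner_add_left)
  have "\<gamma> \<noteq> 0"
  proof
    assume "\<gamma> = 0"
    then have "\<alpha> = 0" "\<beta> = 0" using v \<gamma> by (auto simp: \<gamma>_def)
    then show False using L normal(1)[OF arr HKL(3)] by simp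
  qed
  moreover have "normal L \<bullet> x = \<gamma> * (crossing K x v - crossing H x v)" for x
  proof -
    have "normal H \<bullet> x = - (normal H \<bullet> v) * crossing H x v" "normal K \<bullet> x = - (normal K \<bullet> v) * crossing K x v"
      using v by (simp_all add: crossing_def)
    then have "normal L \<bullet> x = - \<gamma> * crossing H x v - (\<beta> * (normal K \<bullet> v)) * crossing K x v"
      by (simp add: L \<gamma>_def inner_add_left)
    then show ?thesis unfolding \<gamma> by (simp add: algebra_simps)
  qed
  ultimately show ?thesis using that by blast
qed

text \<open>The base point is kept out, which makes the assumptions symmetric under changing v to
  \<open>- v\<close>; an orientation is fixed only where a base point is given.\<close>

locale transverse_extension =
  fixes \<H> \<H>0 :: "'a::euclidean_space set set" and v :: 'a
  assumes arr: "arrangement \<H>" and subset: "\<H>0 \<subseteq> \<H>"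
    and parallel: "H \<in> \<H>0 \<Longrightarrow> normal H \<bullet> v = 0"
    and transverse: "H \<in> \<H> - \<H>0 \<Longrightarrow> normal H \<bullet> v \<noteq> 0"
    and modular: "H \<in> \<H> - \<H>0 \<Longrightarrow> K \<in> \<H> - \<H>0 \<Longrightarrow> H \<noteq> K \<Longrightarrow> \<exists>L\<in>\<H>0. H \<inter> K \<subseteq> L"
begin

lemma arr0: "arrangement \<H>0"
  using arr subset by (rule arrangement_subset)

lemma not_in_Union0: "x \<notin> \<Union>\<H> \<Longrightarrow> x \<notin> \<Union>\<H>0"
  using subset by blast

lemma pencil:
  assumes "H \<in> \<H> - \<H>0" "K \<in> \<H> - \<H>0" "H \<noteq> K"
  obtains L \<gamma> where "L \<in> \<H>0" "\<gamma> \<noteq> 0" "\<And>x. normal L \<bullet> x = \<gamma> * (crossing K x v - crossing H x v)"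
proof -
  obtain L where L: "L \<in> \<H>0" "H \<inter> K \<subseteq> L" using modular assms by blast
  have "H \<in> \<H>" "K \<in> \<H>" "L \<in> \<H>" using L assms subset by auto
  then obtain \<gamma> where "\<gamma> \<noteq> 0" "\<And>x. normal L \<bullet> x = \<gamma> * (crossing K x v - crossing H x v)"
    using pencil_coordinates[OF arr _ _ _ L(2) parallel[OF L(1)]] transverse assms by metis
  then show ?thesis using that L(1) by blast
qed

text \<open>Equal crossing times would put x on the hyperplane L of \<H>0 through H \<inter>
  K.\<close>

lemma crossing_neq:
  assumes "x \<notin> \<Union>\<H>0" "H \<in> \<H>" "K \<in> \<H>" "H \<noteq> K" "normal H \<bullet> v \<noteq> 0" "normal K \<bullet> v \<noteq> 0"
  shows "crossing H x v \<noteq> crossing K x v"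
proof -
  have "H \<in> \<H> - \<H>0" "K \<in> \<H> - \<H>0" using assms parallel by blast+
  then obtain L \<gamma> where L: "L \<in> \<H>0" "normal L \<bullet> x = \<gamma> * (crossing K x v - crossing H x v)"
    using pencil assms(4) by metis
  then show ?thesis using assms(1) not_in_Union_iff[OF arr0] by fastforce
qed

lemma cell0_on_line: "cell \<H>0 (x + t *\<^sub>R v) = cell \<H>0 x"
  unfolding cell_def by (auto simp: inner_add_right parallel)

lemma fibre_neighbour:
  assumes b: "b \<notin> \<Union>\<H>" and H: "H \<in> \<H> - \<H>0" "(normal H \<bullet> b) * (normal H \<bullet> v) < 0"
  obtains z K where "z \<notin> \<Union>\<H>" "cell \<H>0 z = cell \<H>0 b" "sep \<H> b z = {K}"
    "(normal K \<bullet> b) * (normal K \<bullet> v) < 0"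
proof -
  define P where "P = {H\<in>\<H>. normal H \<bullet> v \<noteq> 0 \<and> 0 < crossing H b v}"
  have "H \<in> P" using H by (auto simp: P_def crossing_def mult_less_0_iff divide_less_0_iff)
  then have "P \<noteq> {}" by blast
  moreover have "inj_on (\<lambda>H. crossing H b v) P"
    using crossing_neq not_in_Union0[OF b] by (auto simp: inj_on_def P_def)
  ultimately obtain K t where K: "K \<in> P" "b + t *\<^sub>R v \<notin> \<Union>\<H>" "sep \<H> b (b + t *\<^sub>R v) = {K}"
    using first_crossing[OF arr b P_def] by metis
  have "(normal K \<bullet> b) * (normal K \<bullet> v) < 0"
    using K(1) by (auto simp: P_def crossing_def mult_less_0_iff divide_less_0_iff)
  then show ?thesis using that[OF K(2) cell0_on_line K(3)] by blast
qed

text \<open>A region of \<H>0 is open, so it is not covered by finitely many hyperplanes; this makes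
  the projection of regions surjective.\<close>

lemma generic_representative:
  assumes "R \<in> regions \<H>0"
  obtains x where "x \<notin> \<Union>\<H>" "R = cell \<H>0 x"
proof -
  obtain y where y: "y \<notin> \<Union>\<H>0" "R = cell \<H>0 y" using regionE[OF arr0 assms] .
  then have "R \<noteq> {}" using mem_cell_self[OF arr0] by blast
  moreover have "finite (normal ` \<H>)" using arrangement_finite[OF arr] by simp
  moreover have "0 \<notin> normal ` \<H>" using normal(1)[OF arr] by force
  ultimately obtain x where x: "x \<in> R" "\<And>w. w \<in> normal ` \<H> \<Longrightarrow> w \<bullet> x \<noteq> 0"
    using open_avoids_hyperplanes open_cell[OF arr0] y(2) by metis
  then have "x \<notin> \<Union>\<H>" using not_in_Union_iff[OF arr] by blast
  then show ?thesis using that region_eq_cell(1)[OF arr0 assms x(1)] by blast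
qed

theorem hamiltonian_quotients_regions:
  assumes b: "b \<notin> \<Union>\<H>"
    and base: "\<And>H. H \<in> \<H> - \<H>0 \<Longrightarrow> (normal H \<bullet> b) * (normal H \<bullet> v) < 0"
    and IH: "hamiltonian_quotients (regions \<H>0) (pr_le \<H>0 (cell \<H>0 b))"
  shows "hamiltonian_quotients (regions \<H>) (pr_le \<H> (cell \<H> b))"
proof -
  note b0 = not_in_Union0[OF b]
  have sep0: "sep \<H>0 b x = sep \<H> b x \<inter> \<H>0" for x using subset by (auto simp: sep_def)
  \<comment> \<open>By \<open>base\<close>, every transverse hyperplane lies ahead of b in direction
    v; it separates b from x exactly if it is already behind x.\<close>
  have sep_iff: "H \<in> sep \<H> b x \<longleftrightarrow> crossing H x v < 0" if "H \<in> \<H> - \<H>0" for H x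
    using that base[OF that]
    by (auto simp: sep_def crossing_def mult_less_0_iff divide_less_0_iff zero_less_divide_iff)
  interpret chain_extension "regions \<H>" "pr_le \<H> (cell \<H> b)" "sep_hyps \<H> (cell \<H> b)"
    "regions \<H>0" "pr_le \<H>0 (cell \<H>0 b)" "sep_hyps \<H>0 (cell \<H>0 b)" "reg_proj \<H>0" \<H>0 "\<H> - \<H>0"
  proof
    show "finite (regions \<H>)" using finite_regions[OF arr] .
    show "finite (\<H> - \<H>0)" using arrangement_finite[OF arr] by simp
    show "\<H>0 \<inter> (\<H> - \<H>0) = {}" by blast
    show "inj_on (sep_hyps \<H> (cell \<H> b)) (regions \<H>)" by (rule inj_on_sep_hyps[OF arr b])
    show "inj_on (sep_hyps \<H>0 (cell \<H>0 b)) (regions \<H>0)" by (rule inj_on_sep_hyps[OF arr0 b0])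
    show "sep_hyps \<H> (cell \<H> b) R \<subseteq> \<H>0 \<union> (\<H> - \<H>0)" for R by (auto simp: sep_hyps_def)
    show "pr_le \<H> (cell \<H> b) R R' \<longleftrightarrow> sep_hyps \<H> (cell \<H> b) R \<subseteq> sep_hyps \<H> (cell \<H> b) R'"
      if R: "R \<in> regions \<H>" "R' \<in> regions \<H>" for R R'
    proof -
      obtain x y where "x \<notin> \<Union>\<H>" "R = cell \<H> x" "y \<notin> \<Union>\<H>" "R' = cell \<H> y"
        using R regionE[OF arr] by metis
      then show ?thesis using pr_le_cell_iff[OF arr b] sep_hyps_cell[OF arr b] by simp
    qed
    show "pr_le \<H>0 (cell \<H>0 b) R R' \<longleftrightarrow> sep_hyps \<H>0 (cell \<H>0 b) R \<subseteq> sep_hyps \<H>0 (cell \<H>0 b) R'"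
      if R: "R \<in> regions \<H>0" "R' \<in> regions \<H>0" for R R'
    proof -
      obtain x y where "x \<notin> \<Union>\<H>0" "R = cell \<H>0 x" "y \<notin> \<Union>\<H>0" "R' = cell \<H>0 y"
        using R regionE[OF arr0] by metis
      then show ?thesis using pr_le_cell_iff[OF arr0 b0] sep_hyps_cell[OF arr0 b0] by simp
    qed
    show "reg_proj \<H>0 ` regions \<H> = regions \<H>0"
    proof (intro equalityI subsetI)
      fix R0 assume "R0 \<in> reg_proj \<H>0 ` regions \<H>"
      then obtain R where "R \<in> regions \<H>" "R0 = reg_proj \<H>0 R" by blast
      then obtain x where x: "x \<notin> \<Union>\<H>" "R0 = cell \<H>0 x"
        using regionE[OF arr] reg_proj_cell[OF arr subset] by metis
      then show "R0 \<in> regions \<H>0" using cell_in_regions[OF arr0] not_in_Union0 by blast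
    next
      fix R0 assume "R0 \<in> regions \<H>0"
      then obtain x where x: "x \<notin> \<Union>\<H>" "R0 = cell \<H>0 x" by (rule generic_representative)
      then have "R0 = reg_proj \<H>0 (cell \<H> x)" using reg_proj_cell[OF arr subset] by simp
      then show "R0 \<in> reg_proj \<H>0 ` regions \<H>" using cell_in_regions[OF arr x(1)] by blast
    qed
    show "sep_hyps \<H>0 (cell \<H>0 b) (reg_proj \<H>0 R) = sep_hyps \<H> (cell \<H> b) R \<inter> \<H>0"
      if R: "R \<in> regions \<H>" for R
    proof -
      obtain x where x: "x \<notin> \<Union>\<H>" "R = cell \<H> x" using regionE[OF arr R] .
      then show ?thesis
        using reg_proj_cell[OF arr subset x(1)] sep_hyps_cell[OF arr b x(1)]
          sep_hyps_cell[OF arr0 b0 not_in_Union0[OF x(1)]] sep0 by simp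
    qed
  next
    fix H K assume HK: "H \<in> \<H> - \<H>0" "K \<in> \<H> - \<H>0" "H \<noteq> K"
    then obtain L \<gamma> where L: "L \<in> \<H>0" "\<gamma> \<noteq> 0" "\<And>x. normal L \<bullet> x = \<gamma> * (crossing K x v - crossing H x v)"
      using pencil by blast
    let ?in = "\<lambda>H R. H \<in> sep_hyps \<H> (cell \<H> b) R"
    \<comment> \<open>Its sign says which of H and K is crossed first on the side of L containing b,
      and so selects the disjunct of \<open>flip\<close>.\<close>
    define \<delta> where "\<delta> = (normal L \<bullet> b) * \<gamma>"
    have "\<delta> \<noteq> 0" using L b0 not_in_Union_iff[OF arr0] by (auto simp: \<delta>_def)
    have L_in: "L \<in> sep \<H> b x \<longleftrightarrow> \<delta> * (crossing K x v - crossing H x v) < 0" for x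
      using L(1,3) subset by (auto simp: sep_def \<delta>_def mult.assoc)
    have R: "\<exists>x. x \<notin> \<Union>\<H> \<and> sep_hyps \<H> (cell \<H> b) R = sep \<H> b x" if "R \<in> regions \<H>" for R
      using regionE[OF arr that] sep_hyps_cell[OF arr b] by metis
    show "\<exists>L\<in>\<H>0. (\<forall>R\<in>regions \<H>. (?in L R \<longrightarrow> ?in H R \<longrightarrow> ?in K R) \<and> (\<not> ?in L R \<longrightarrow> ?in K R \<longrightarrow> ?in H R)) \<or>
        (\<forall>R\<in>regions \<H>. (?in L R \<longrightarrow> ?in K R \<longrightarrow> ?in H R) \<and> (\<not> ?in L R \<longrightarrow> ?in H R \<longrightarrow> ?in K R))"
    proof (intro bexI[OF _ L(1)])
      show "(\<forall>R\<in>regions \<H>. (?in L R \<longrightarrow> ?in H R \<longrightarrow> ?in K R) \<and> (\<not> ?in L R \<longrightarrow> ?in K R \<longrightarrow> ?in H R)) \<or>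
        (\<forall>R\<in>regions \<H>. (?in L R \<longrightarrow> ?in K R \<longrightarrow> ?in H R) \<and> (\<not> ?in L R \<longrightarrow> ?in H R \<longrightarrow> ?in K R))"
      proof (cases "0 < \<delta>")
        case True
        have "(?in L R \<longrightarrow> ?in H R \<longrightarrow> ?in K R) \<and> (\<not> ?in L R \<longrightarrow> ?in K R \<longrightarrow> ?in H R)"
          if "R \<in> regions \<H>" for R
        proof -
          obtain x where "sep_hyps \<H> (cell \<H> b) R = sep \<H> b x" using R \<open>R \<in> regions \<H>\<close> by blast
          then show ?thesis
            using True L_in[of x] sep_iff[OF HK(1), of x] sep_iff[OF HK(2), of x]
            by (auto simp: mult_less_0_iff)
        qed
        then show ?thesis by blast
      next
        case False
        have "(?in L R \<longrightarrow> ?in K R \<longrightarrow> ?in H R) \<and> (\<not> ?in L R \<longrightarrow> ?in H R \<longrightarrow> ?in K R)"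
          if "R \<in> regions \<H>" for R
        proof -
          obtain x where "sep_hyps \<H> (cell \<H> b) R = sep \<H> b x" using R \<open>R \<in> regions \<H>\<close> by blast
          then show ?thesis
            using False \<open>\<delta> \<noteq> 0\<close> L_in[of x] sep_iff[OF HK(1), of x] sep_iff[OF HK(2), of x]
            by (auto simp: mult_less_0_iff)
        qed
        then show ?thesis by blast
      qed
    qed
  next
    fix R0 H assume R0: "R0 \<in> regions \<H>0" and H: "H \<in> \<H> - \<H>0"
    obtain x where x: "x \<notin> \<Union>\<H>" "R0 = cell \<H>0 x" using generic_representative[OF R0] .
    have ne: "crossing K x v \<noteq> crossing H x v" if "K \<in> \<H>" "K \<noteq> H" "normal K \<bullet> v \<noteq> 0" for K
      using crossing_neq[OF not_in_Union0[OF x(1)]] that H transverse by blast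
    have "H \<in> \<H>" using H by blast
    \<comment> \<open>The regions just before and just after the crossing of H differ in H only and
      lie over the same region of \<H>0, as \<open>insertion\<close> requires.\<close>
    obtain s t where "crossing H x v < t" and st: "s < crossing H x v" "x + s *\<^sub>R v \<notin> \<Union>\<H>" "x + t *\<^sub>R v \<notin> \<Union>\<H>"
      "sep \<H> (x + s *\<^sub>R v) (x + t *\<^sub>R v) = {H}"
      by (rule crossing_pair[OF arr x(1) \<open>H \<in> \<H>\<close> transverse[OF H]]) (use ne in blast)+
    have "crossing H (x + s *\<^sub>R v) v = crossing H x v - s"
      using transverse[OF H] by (simp add: crossing_def inner_add_right field_simps)
    then have H_notin: "H \<notin> sep \<H> b (x + s *\<^sub>R v)"
      using sep_iff[OF H] st(1) by simp
    show "\<exists>R\<in>regions \<H>. \<exists>R'\<in>regions \<H>. reg_proj \<H>0 R = R0 \<and> H \<notin> sep_hyps \<H> (cell \<H> b) R \<and>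
        sep_hyps \<H> (cell \<H> b) R' = insert H (sep_hyps \<H> (cell \<H> b) R)"
    proof (intro bexI conjI)
      show "reg_proj \<H>0 (cell \<H> (x + s *\<^sub>R v)) = R0"
        using reg_proj_cell[OF arr subset st(2)] cell0_on_line x(2) by simp
      show "H \<notin> sep_hyps \<H> (cell \<H> b) (cell \<H> (x + s *\<^sub>R v))"
        using H_notin sep_hyps_cell[OF arr b st(2)] by simp
      show "sep_hyps \<H> (cell \<H> b) (cell \<H> (x + t *\<^sub>R v)) =
          insert H (sep_hyps \<H> (cell \<H> b) (cell \<H> (x + s *\<^sub>R v)))"
        using sep_insert[OF arr b st(2,3,4) H_notin] sep_hyps_cell[OF arr b] st(2,3) by simp
    qed (use cell_in_regions[OF arr] st(2,3) in blast)+
  qed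
  show ?thesis using hamiltonian_quotients_extension[OF IH] .
qed

end

lemma transverse_extension_uminus:
  "transverse_extension \<H> \<H>0 v \<Longrightarrow> transverse_extension \<H> \<H>0 (- v)"
  by (auto simp: transverse_extension_def)

text \<open>If hyperplanes of \<open>\<H> - \<H>0\<close> are met both forwards and backwards along the line through \<open>b\<close>,
  then the region of \<open>b\<close> has two neighbours in its fibre.\<close>

lemma (in transverse_extension) end_of_fibre:
  assumes b: "b \<notin> \<Union>\<H>"
    and card: "card {R'\<in>regions \<H>. reg_proj \<H>0 R' = reg_proj \<H>0 (cell \<H> b) \<and> reg_adj \<H> (cell \<H> b) R'} \<le> 1"
  shows "(\<forall>H\<in>\<H> - \<H>0. (normal H \<bullet> b) * (normal H \<bullet> v) < 0) \<or>
         (\<forall>H\<in>\<H> - \<H>0. (normal H \<bullet> b) * (normal H \<bullet> - v) < 0)"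
proof (rule ccontr)
  assume "\<not> ?thesis"
  then obtain H K where HK: "H \<in> \<H> - \<H>0" "\<not> (normal H \<bullet> b) * (normal H \<bullet> v) < 0"
    "K \<in> \<H> - \<H>0" "\<not> (normal K \<bullet> b) * (normal K \<bullet> - v) < 0" by blast
  define N where "N = {R'\<in>regions \<H>. reg_proj \<H>0 R' = reg_proj \<H>0 (cell \<H> b) \<and> reg_adj \<H> (cell \<H> b) R'}"
  interpret neg: transverse_extension \<H> \<H>0 "- v"
    by (rule transverse_extension_uminus) unfold_locales
  have nz: "normal H \<bullet> b \<noteq> 0" "normal K \<bullet> b \<noteq> 0"
    using HK b not_in_Union_iff[OF arr] by blast+
  have "(normal H \<bullet> b) * (normal H \<bullet> - v) < 0"
    using HK(2) transverse[OF HK(1)] nz by (auto simp: mult_less_0_iff zero_less_mult_iff linorder_neq_iff)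
  then obtain z1 K1 where 1: "z1 \<notin> \<Union>\<H>" "cell \<H>0 z1 = cell \<H>0 b" "sep \<H> b z1 = {K1}"
    "(normal K1 \<bullet> b) * (normal K1 \<bullet> - v) < 0"
    using neg.fibre_neighbour[OF b HK(1)] by blast
  have "(normal K \<bullet> b) * (normal K \<bullet> v) < 0"
    using HK(4) transverse[OF HK(3)] nz by (auto simp: mult_less_0_iff zero_less_mult_iff linorder_neq_iff)
  then obtain z2 K2 where 2: "z2 \<notin> \<Union>\<H>" "cell \<H>0 z2 = cell \<H>0 b" "sep \<H> b z2 = {K2}"
    "(normal K2 \<bullet> b) * (normal K2 \<bullet> v) < 0"
    using fibre_neighbour[OF b HK(3)] by blast
  have N: "cell \<H> z1 \<in> N" "cell \<H> z2 \<in> N"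
    unfolding N_def using 1 2 b
    by (simp_all add: cell_in_regions[OF arr] reg_proj_cell[OF arr subset] reg_adj_cell[OF arr])
  \<comment> \<open>One is met backwards and the other forwards, so their sign products
    differ.\<close>
  have "K1 \<noteq> K2" using 1(4) 2(4) by auto
  then have "cell \<H> z1 \<noteq> cell \<H> z2"
    using 1(3) 2(3) sep_hyps_cell[OF arr b 1(1)] sep_hyps_cell[OF arr b 2(1)] by auto
  then have "card {cell \<H> z1, cell \<H> z2} = 2" by simp
  moreover have "finite N" using finite_regions[OF arr] by (simp add: N_def)
  ultimately have "2 \<le> card N" using N card_mono[of N "{cell \<H> z1, cell \<H> z2}"] by simp
  then show False using card by (simp add: N_def)
qed

text \<open>Take v in the larger span orthogonal to the smaller one. Some K is transverse to v,
  since otherwise v would be orthogonal to itself.\<close>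

lemma rank_drop_transverse:
  assumes arr: "arrangement \<H>" and sub: "\<H>0 \<subseteq> \<H>" and rank: "arr_rank \<H>0 < arr_rank \<H>"
    and mod: "\<forall>H\<in>\<H> - \<H>0. \<forall>K\<in>\<H> - \<H>0. H \<noteq> K \<longrightarrow> (\<exists>L\<in>\<H>0. H \<inter> K \<subseteq> L)"
  obtains v where "transverse_extension \<H> \<H>0 v"
proof -
  have normal_in: "normal H \<in> normals \<K>" if "arrangement \<K>" "H \<in> \<K>" for H :: "'a set" and \<K>
    unfolding normals_def using normal[OF that] that(2) by blast
  have "span (normals \<H>0) \<subseteq> span (normals \<H>)"
    by (rule span_mono) (use sub in \<open>auto simp: normals_def\<close>)
  moreover have "span (normals \<H>0) \<noteq> span (normals \<H>)"
    using rank unfolding arr_rank_def by (metis less_irrefl)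
  ultimately obtain v where v: "v \<noteq> 0" "v \<in> span (normals \<H>)"
    "\<And>y. y \<in> span (normals \<H>0) \<Longrightarrow> orthogonal v y"
    using orthogonal_to_subspace_exists_gen by blast
  have par: "normal H \<bullet> v = 0" if "H \<in> \<H>0" for H
    using v(3) normal_in[OF arrangement_subset[OF arr sub] that] span_base
    by (force simp: orthogonal_def inner_commute)
  have "\<exists>K\<in>\<H>. normal K \<bullet> v \<noteq> 0"
  proof (rule ccontr)
    assume n: "\<not> ?thesis"
    have "orthogonal v a" if a: "a \<in> normals \<H>" for a
    proof -
      obtain H where H: "H \<in> \<H>" "H = {x. a \<bullet> x = 0}" using a unfolding normals_def by blast
      then have "{x. normal H \<bullet> x = 0} = {x. a \<bullet> x = 0}" using normal(2)[OF arr H(1)] by blast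
      then obtain \<alpha> where "a = \<alpha> *\<^sub>R normal H" using hyperplane_eq_imp_parallel by blast
      then show ?thesis using n H(1) by (simp add: orthogonal_def inner_commute)
    qed
    then have "orthogonal v v" using orthogonal_to_span[OF v(2)] by blast
    then show False using v(1) by (simp add: orthogonal_def)
  qed
  then obtain K where K: "K \<in> \<H>" "normal K \<bullet> v \<noteq> 0" by blast
  then have "K \<notin> \<H>0" using par by blast
  have trans: "normal H \<bullet> v \<noteq> 0" if H: "H \<in> \<H> - \<H>0" for H
  proof
    assume Hv: "normal H \<bullet> v = 0"
    then have "H \<noteq> K" using K by blast
    then obtain L where L: "L \<in> \<H>0" "H \<inter> K \<subseteq> L" using mod H K \<open>K \<notin> \<H>0\<close> by blast
    then have LH: "L \<in> \<H>" using sub by blast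
    have "normal L \<bullet> x = 0" if "normal H \<bullet> x = 0" "normal K \<bullet> x = 0" for x
      using that L(2) normal(2)[OF arr, of H] normal(2)[OF arr K(1)] normal(2)[OF arr LH] H by blast
    then obtain \<alpha> \<beta> where eq: "normal L = \<alpha> *\<^sub>R normal H + \<beta> *\<^sub>R normal K"
      using span_pair_of_kernel by blast
    \<comment> \<open>Modularity spreads transversality from K: if H were parallel to v, pairing
      with v would kill the K-coefficient and make H equal to L, a member of \<H>0.\<close>
    have "\<beta> = 0" using arg_cong[OF eq, of "\<lambda>x. x \<bullet> v"] par[OF L(1)] Hv K(2) by (simp add: inner_add_left)
    then have "L = H" using normals_parallel_imp_eq[OF arr LH, of H \<alpha>] H eq by simp
    then show False using H L(1) by blast
  qed
  have "transverse_extension \<H> \<H>0 v"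
    by unfold_locales (use arr sub par trans mod in auto)
  then show ?thesis using that by blast
qed

section \<open>Rank at most two\<close>

lemma hamiltonian_quotients_singleton:
  assumes "le a a"
  shows "hamiltonian_quotients {a} le"
  unfolding hamiltonian_quotients_def
proof (intro conjI allI impI)
  show "lattice_on {a} le"
    using assms by (simp add: lattice_on_def partial_order_on_rel_def is_lub_def is_glb_def)
  fix E assume "lattice_congruence {a} le E"
  show "cover_graph_ham_path ({a} // E) (quot_le le)"
    unfolding cover_graph_ham_path_def
    by (intro exI[of _ "[E `` {a}]"]) (simp add: singleton_quotient)
qed

lemma hamiltonian_quotients_empty_arrangement:
  "hamiltonian_quotients (regions {}) (pr_le {} (cell {} (b :: 'a::euclidean_space)))"
proof -
  have "R = cell {} b" if R: "R \<in> regions {}" for R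
  proof -
    have "arrangement ({} :: 'a set set)" by (simp add: arrangement_def)
    then obtain x where "R = cell {} x" using regionE R by blast
    then show ?thesis by (simp add: cell_def)
  qed
  moreover have "cell {} b \<in> regions {}"
    by (rule cell_in_regions) (simp_all add: arrangement_def)
  ultimately have "regions {} = {cell {} b}" by blast
  then show ?thesis by (simp add: hamiltonian_quotients_singleton pr_le_def)
qed

text \<open>Rescaled to \<open>u \<bullet> b = 1\<close>, the normals lie on a line; the extreme ones belong to the walls
  of the region of \<open>b\<close>.\<close>

lemma rank_two_wall:
  assumes arr: "arrangement \<H>" and rank: "arr_rank \<H> \<le> 2" and b: "b \<notin> \<Union>\<H>" and "\<H> \<noteq> {}"
  obtains W v where "W \<in> \<H>" "transverse_extension \<H> {W} v"
    "\<And>H. H \<in> \<H> - {W} \<Longrightarrow> (normal H \<bullet> b) * (normal H \<bullet> v) < 0"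
proof -
  define u where "u H = (1 / (normal H \<bullet> b)) *\<^sub>R normal H" for H
  have nz: "normal H \<bullet> b \<noteq> 0" if "H \<in> \<H>" for H using b not_in_Union_iff[OF arr] that by blast
  have ub: "u H \<bullet> b = 1" if "H \<in> \<H>" for H using nz[OF that] by (simp add: u_def)
  have nu: "normal H = (normal H \<bullet> b) *\<^sub>R u H" if "H \<in> \<H>" for H using nz[OF that] by (simp add: u_def)
  have u_inj: "H = K" if "H \<in> \<H>" "K \<in> \<H>" "u H = u K" for H K
  proof (rule normals_parallel_imp_eq[OF arr that(1,2)])
    show "normal H = ((normal H \<bullet> b) / (normal K \<bullet> b)) *\<^sub>R normal K"
      using nu[OF that(1)] unfolding that(3) by (simp add: u_def)
  qed
  have u_in: "u H \<in> span (normals \<H>)" if "H \<in> \<H>" for H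
  proof -
    have "normal H \<in> normals \<H>" unfolding normals_def using normal[OF arr that] that by blast
    then show ?thesis unfolding u_def by (intro span_mul span_base)
  qed
  obtain H1 where H1: "H1 \<in> \<H>" using assms(4) by blast
  \<comment> \<open>The direction q of the line carrying the rescaled normals: rank at most two
    leaves at most two independent ones, and pairing with b forces the coefficients to sum to
    1.\<close>
  have "\<exists>q. \<forall>H\<in>\<H>. \<exists>c. u H - u H1 = c *\<^sub>R q"
  proof (cases "\<H> = {H1}")
    case True
    then show ?thesis by auto
  next
    case False
    then obtain H2 where H2: "H2 \<in> \<H>" "H2 \<noteq> H1" using H1 by blast
    have ne: "u H1 \<noteq> u H2" using u_inj H1 H2 by blast
    have "u H1 \<noteq> 0" "u H2 \<noteq> 0" using ub H1 H2 by force+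
    have "u H1 \<notin> span {u H2}"
    proof
      assume "u H1 \<in> span {u H2}"
      then obtain c where c: "u H1 = c *\<^sub>R u H2" by (auto simp: span_singleton)
      then have "c = 1" using ub[OF H1] ub[OF H2(1)] by simp
      then show False using c ne by simp
    qed
    then have ind: "independent {u H1, u H2}"
      using \<open>u H2 \<noteq> 0\<close> ne by (simp add: independent_insert)
    have "\<exists>c. u H - u H1 = c *\<^sub>R (u H2 - u H1)" if H: "H \<in> \<H>" for H
    proof -
      have "u H \<in> span {u H1, u H2}"
      proof (rule ccontr)
        assume n: "u H \<notin> span {u H1, u H2}"
        then have "u H \<notin> {u H1, u H2}" using span_base[of "u H" "{u H1, u H2}"] by metis
        then have "card {u H, u H1, u H2} = 3" using ne by auto
        moreover have "independent {u H, u H1, u H2}"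
          by (intro independent_insertI n ind)
        moreover have "{u H, u H1, u H2} \<subseteq> span (normals \<H>)" using u_in H H1 H2 by blast
        ultimately have "3 \<le> dim (span (normals \<H>))"
          using independent_card_le_dim[of "{u H, u H1, u H2}" "span (normals \<H>)"] by simp
        then show False using rank by (simp add: arr_rank_def)
      qed
      then obtain \<alpha> \<beta> where ab: "u H - \<alpha> *\<^sub>R u H1 = \<beta> *\<^sub>R u H2"
        by (auto simp: span_insert span_singleton)
      then have eq: "u H = \<alpha> *\<^sub>R u H1 + \<beta> *\<^sub>R u H2" by (simp add: algebra_simps)
      then have "1 = \<alpha> + \<beta>" using ub[OF H] ub[OF H1] ub[OF H2(1)] by (simp add: inner_add_left)
      then have \<alpha>: "\<alpha> = 1 - \<beta>" by simp
      have "u H - u H1 = \<beta> *\<^sub>R (u H2 - u H1)" unfolding eq \<alpha> by (simp add: algebra_simps)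
      then show ?thesis by blast
    qed
    then show ?thesis by blast
  qed
  then obtain q c where qc: "\<And>H. H \<in> \<H> \<Longrightarrow> u H - u H1 = c H *\<^sub>R q" by metis
  have diff: "u H - u K = (c H - c K) *\<^sub>R q" if "H \<in> \<H>" "K \<in> \<H>" for H K
    using qc[OF that(1)] qc[OF that(2)] by (simp add: algebra_simps)
  have fin: "finite ((\<lambda>H. q \<bullet> u H) ` \<H>)" using arrangement_finite[OF arr] by simp
  then have "Min ((\<lambda>H. q \<bullet> u H) ` \<H>) \<in> (\<lambda>H. q \<bullet> u H) ` \<H>" using assms(4) by simp
  then obtain W where W: "W \<in> \<H>" "q \<bullet> u W = Min ((\<lambda>H. q \<bullet> u H) ` \<H>)" by auto
  have W_less: "q \<bullet> u W < q \<bullet> u H" if H: "H \<in> \<H> - {W}" for H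
  proof -
    have "q \<bullet> u W \<le> q \<bullet> u H" using W(2) fin H by simp
    moreover have "q \<bullet> u H \<noteq> q \<bullet> u W"
    proof
      assume eq: "q \<bullet> u H = q \<bullet> u W"
      have "(c H - c W) * (q \<bullet> q) = q \<bullet> (u H - u W)" using diff[of H W] H W by simp
      then have "(c H - c W) *\<^sub>R q = 0" using eq by (auto simp: inner_diff_right)
      then show False using diff[of H W] H W u_inj[of H W] by auto
    qed
    ultimately show ?thesis by simp
  qed
  \<comment> \<open>Chosen so that \<open>u H \<bullet> v\<close> equals
    \<open>q \<bullet> u W - q \<bullet> u H\<close>: zero for \<open>W\<close> and, by minimality
    of \<open>W\<close>, negative for all other hyperplanes.\<close>
  define v where "v = (q \<bullet> u W) *\<^sub>R b - q"
  have uv: "u H \<bullet> v = q \<bullet> u W - q \<bullet> u H" if "H \<in> \<H>" for H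
    using ub[OF that] by (simp add: v_def inner_diff_right inner_commute)
  have nv: "normal H \<bullet> v = (normal H \<bullet> b) * (q \<bullet> u W - q \<bullet> u H)" if "H \<in> \<H>" for H
    using arg_cong[OF nu[OF that], of "\<lambda>x. x \<bullet> v"] uv[OF that] by simp
  have neg: "(normal H \<bullet> b) * (normal H \<bullet> v) < 0" if "H \<in> \<H> - {W}" for H
    using W_less[OF that] nv[of H] nz[of H] that
    by (auto simp: mult_less_0_iff zero_less_mult_iff linorder_neq_iff)
  have "transverse_extension \<H> {W} v"
  proof
    show "arrangement \<H>" "{W} \<subseteq> \<H>" using arr W by auto
    show "normal H \<bullet> v = 0" if "H \<in> {W}" for H using that nv W by auto
    show "normal H \<bullet> v \<noteq> 0" if "H \<in> \<H> - {W}" for H using neg[OF that] by auto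
    show "\<exists>L\<in>{W}. H \<inter> K \<subseteq> L" if HK: "H \<in> \<H> - {W}" "K \<in> \<H> - {W}" "H \<noteq> K" for H K
    proof -
      have HK': "H \<in> \<H>" "K \<in> \<H>" using HK by auto
      have "c H \<noteq> c K" using diff[OF HK'] u_inj[OF HK'] HK(3) by auto
      \<comment> \<open>Two distinct points of the line of normals determine it, so x, being
        orthogonal to both, is orthogonal to q and to every \<open>u\<close>.\<close>
      have "x \<in> W" if x: "x \<in> H" "x \<in> K" for x
      proof -
        have "u H \<bullet> x = 0" "u K \<bullet> x = 0"
          using x normal(2)[OF arr HK'(1)] normal(2)[OF arr HK'(2)] by (auto simp: u_def)
        moreover from this have "(c H - c K) * (q \<bullet> x) = 0"
          using arg_cong[OF diff[OF HK'], of "\<lambda>y. y \<bullet> x"] by (simp add: inner_diff_left)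
        then have "q \<bullet> x = 0" using \<open>c H \<noteq> c K\<close> by simp
        ultimately have "u W \<bullet> x = 0"
          using arg_cong[OF diff[OF W(1) HK'(1)], of "\<lambda>y. y \<bullet> x"] by (simp add: inner_diff_left)
        then have "normal W \<bullet> x = 0" using nz[OF W(1)] by (simp add: u_def)
        then show ?thesis using normal(2)[OF arr W(1)] by blast
      qed
      then show ?thesis by blast
    qed
  qed
  then show ?thesis using that W(1) neg by blast
qed

lemma hamiltonian_quotients_rank_two:
  assumes arr: "arrangement \<H>" and rank: "arr_rank \<H> \<le> 2" and b: "b \<notin> \<Union>\<H>"
  shows "hamiltonian_quotients (regions \<H>) (pr_le \<H> (cell \<H> b))"
proof (cases "\<H> = {}")
  case True
  then show ?thesis using hamiltonian_quotients_empty_arrangement by simp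
next
  case False
  then obtain W v where W: "W \<in> \<H>" "transverse_extension \<H> {W} v"
    and v: "\<And>H. H \<in> \<H> - {W} \<Longrightarrow> (normal H \<bullet> b) * (normal H \<bullet> v) < 0"
    using rank_two_wall[OF arr rank b] by metis
  \<comment> \<open>Points from b towards \<open>W\<close>, so that b is on the initial side when
    \<open>W\<close> is added to the empty arrangement.\<close>
  define w where "w = - (normal W \<bullet> b) *\<^sub>R normal W"
  have neg: "(normal W \<bullet> b) * (normal W \<bullet> w) < 0"
    using b W(1) not_in_Union_iff[OF arr] normal(1)[OF arr W(1)]
    by (auto simp: w_def mult_less_0_iff zero_less_mult_iff linorder_neq_iff)
  interpret one: transverse_extension "{W}" "{}" w
    by unfold_locales (use neg arrangement_subset[OF arr, of "{W}"] W(1) in auto)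
  interpret two: transverse_extension \<H> "{W}" v by (rule W(2))
  have "hamiltonian_quotients (regions {W}) (pr_le {W} (cell {W} b))"
    using b W(1) neg hamiltonian_quotients_empty_arrangement
    by (intro one.hamiltonian_quotients_regions) auto
  then show ?thesis using b v by (intro two.hamiltonian_quotients_regions) auto
qed

section \<open>Supersolvable arrangements\<close>

text \<open>The induction follows the decomposition with \<open>R0\<close> arbitrary, since the
  hypothesis is applied to the projected base region. The representative b of \<open>R0\<close> also
  represents that projection.\<close>

lemma hamiltonian_quotients_supersolvable:
  assumes "ss_decomp D" "arrangement (hd D)" "canonical D R0"
  shows "hamiltonian_quotients (regions (hd D)) (pr_le (hd D) R0)"
  using assms
proof (induction D arbitrary: R0 rule: ss_decomp.induct)
  case (base \<H>)
  then have "R0 \<in> regions \<H>" "arrangement \<H>" by simp_all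
  then obtain b where "b \<notin> \<Union>\<H>" "R0 = cell \<H> b" using regionE by blast
  then show ?case using hamiltonian_quotients_rank_two base \<open>arrangement \<H>\<close> by simp
next
  case (step \<H> \<H>0 rest)
  have arr: "arrangement \<H>" using step.prems by simp
  have can: "R0 \<in> regions \<H>" "canonical (\<H>0 # rest) (reg_proj \<H>0 R0)"
    "card {R'\<in>regions \<H>. reg_proj \<H>0 R' = reg_proj \<H>0 R0 \<and> reg_adj \<H> R0 R'} \<le> 1"
    using step.prems(2) by simp_all
  obtain b where b: "b \<notin> \<Union>\<H>" "R0 = cell \<H> b" using regionE[OF arr can(1)] .
  have IH: "hamiltonian_quotients (regions \<H>0) (pr_le \<H>0 (cell \<H>0 b))"
    using step.IH[OF _ can(2)] arrangement_subset[OF arr step.hyps(2)]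
      reg_proj_cell[OF arr step.hyps(2) b(1)] b(2) by simp
  have "arr_rank \<H>0 < arr_rank \<H>" using step.hyps(1,5) by simp
  then obtain v where v: "transverse_extension \<H> \<H>0 v"
    using rank_drop_transverse[OF arr step.hyps(2) _ step.hyps(7)] by blast
  interpret pos: transverse_extension \<H> \<H>0 v by (rule v)
  interpret neg: transverse_extension \<H> \<H>0 "- v" by (rule transverse_extension_uminus[OF v])
  have "(\<forall>H\<in>\<H> - \<H>0. (normal H \<bullet> b) * (normal H \<bullet> v) < 0) \<or>
        (\<forall>H\<in>\<H> - \<H>0. (normal H \<bullet> b) * (normal H \<bullet> - v) < 0)"
    using pos.end_of_fibre[OF b(1)] can(3) b(2) by simp
  then show ?case
    using pos.hamiltonian_quotients_regions[OF b(1) _ IH] neg.hamiltonian_quotients_regions[OF b(1) _ IH] b(2)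
    by auto
qed

theorem theorem1p2:
  fixes \<H> :: "'a::euclidean_space set set"
    and D :: "'a set set list"
    and R0 :: "'a set"
  assumes "arrangement \<H>"
    and "ss_decomp D"
    and "hd D = \<H>"
    and "canonical D R0"
  shows "lattice_on (regions \<H>) (pr_le \<H> R0) \<and>
         (\<forall>E. lattice_congruence (regions \<H>) (pr_le \<H> R0) E \<longrightarrow>
              cover_graph_ham_path (regions \<H> // E) (quot_le (pr_le \<H> R0)))"
  using hamiltonian_quotients_supersolvable[of D R0] assms
  by (simp add: hamiltonian_quotients_def)
end
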